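(* In the setting described in the context, with $\boldsymbol\lambda=\boldsymbol\lambda(T)$, assume that all parameter-dependent Gamma factors occurring in the definitions remain finite. Then, as $T\to+\infty$ (equivalently $L_{\boldsymbol\lambda}=\min_h|\lambda_h|\to\infty$), $$\widehat W^{\boldsymbol\lambda}\longrightarrow W\quad\text{locally uniformly on }\mathbb C,$$ i.e. for every compact $K\subset\mathbb C$ one has $K\subset\{z:|z|<|\Lambda_{\boldsymbol\lambda}|\}$ for all sufficiently large $T$, and $\sup_{z\in K}\|\widehat W^{\boldsymbol\lambda}(z)-W(z)\|\to0$. Equivalently, $$\widehat C^{\boldsymbol\lambda}\longrightarrow C\quad\text{locally uniformly on }\mathbb C\setminus\{0\}.$$ In particular $\sup_{|z|=1}\|\widehat C^{\boldsymbol\lambda}(z)-C(z)\|\to0$.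
   Context: $\mathbf 1_d$ is the all-ones vector, $\boldsymbol e_j$ the $j$-th standard basis vector of $\mathbb C^q$, $\Gamma(\boldsymbol v)=\prod_h\Gamma(v_h)$ (empty product $=1$). Limit matrices. Integers $p,q\ge1$, $0\le r<q$, $\boldsymbol a\in\mathbb C^r$, $\boldsymbol b\in\mathbb C^q$, $\boldsymbol\kappa\in\mathbb C^p$, regular: $b_j-b_h\notin\mathbb Z$ $(j\neq h)$, $\kappa_i-\kappa_h\notin\mathbb Z$ $(i\ne h)$. $W=[W_{j,i}]$ is the $q\times p$ matrix with entire entries $W_{j,i}(z)=\sum_{k\ge0}\frac{\Gamma((k+\kappa_i)\mathbf 1_r+\boldsymbol a+\mathbf 1_r)}{\Gamma((k+\kappa_i)\mathbf 1_q+\boldsymbol b+\boldsymbol e_j+\mathbf 1_q)}z^k$, and $C(z)=\frac1zW(1/z)$, $z\neq0$. Jacobi-like matrix measure. Put $d=q-r$. For $\operatorname{Re}u>-1$, $\operatorname{Re}(v-u)>0$ let $\mathcal B_{u,v}(x)=x^u(1-x)^{v-u-1}/\Gamma(v-u)$, $0<x<1$ (real logarithms). Mellin convolution: $(f*g)(x)=\int_x^1f(t)g(x/t)\frac{\mathrm dt}{t}$. Assume $\operatorname{Re}a_h>-1$, $\operatorname{Re}(b_h-a_h)>0$ for $1\le h\le r$, and $\operatorname{Re}(\kappa_i+a_h+1)>0$ for all $i,h$. Choose real numbers $c_\ell$ with $\max\{-1,\max_i(-1-\operatorname{Re}\kappa_i)\}<c_\ell<\operatorname{Re}b_{r+\ell}$,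 $\ell=1,\dots,d$, and set $\lambda_\ell(T)=c_\ell+\mathrm iT$, $T>0$, $\boldsymbol\lambda=\boldsymbol\lambda(T)=(\lambda_1(T),\dots,\lambda_d(T))$. With $(\alpha_1,\dots,\alpha_q)=(a_1,\dots,a_r,\lambda_1,\dots,\lambda_d)$ let $$w_j^{\mathrm J,\boldsymbol\lambda}=\mathcal B_{\alpha_1,b_1+\delta_{j,1}}*\cdots*\mathcal B_{\alpha_q,b_q+\delta_{j,q}},\quad 1\le j\le q,$$ and let $\mathrm d\mathcal J^{\boldsymbol\lambda}$ be the $q\times p$ matrix of complex measures on $(0,1)$ with entries $\mathrm d\mathcal J^{\boldsymbol\lambda}_{j,i}(x)=w_j^{\mathrm J,\boldsymbol\lambda}(x)x^{\kappa_i}\,\mathrm dx$. Rescaling. $\Lambda_{\boldsymbol\lambda}=\prod_{h=1}^d\lambda_h$, $\mathsf D_{\boldsymbol\lambda}=\operatorname{diag}\big[\prod_{h=1}^d\Gamma(\lambda_h+\kappa_i+1)\big]_{i=1}^p$, $\Delta_{\boldsymbol\lambda}=\Lambda_{\boldsymbol\lambda}^{-1}[0,1]$. The matrix measure $\mathrm d\widehat{\mathcal J}^{\boldsymbol\lambda}$ on $\Delta_{\boldsymbol\lambda}$ is the push-forward of $\mathrm d\mathcal J^{\boldsymbol\lambda}\,\mathsf D_{\boldsymbol\lambda}^{-1}$ under $x\mapsto x/\Lambda_{\boldsymbol\lambda}$. Then $$\widehat C^{\boldsymbol\lambda}(z)=\int_{\Delta_{\boldsymbol\lambda}}\frac{\mathrm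 d\widehat{\mathcal J}^{\boldsymbol\lambda}(y)}{z-y}\ (z\notin\Delta_{\boldsymbol\lambda}),\qquad \widehat W^{\boldsymbol\lambda}(z)=\int_{\Delta_{\boldsymbol\lambda}}\frac{\mathrm d\widehat{\mathcal J}^{\boldsymbol\lambda}(y)}{1-yz},$$ so that $\widehat W^{\boldsymbol\lambda}(z)=\frac1z\widehat C^{\boldsymbol\lambda}(1/z)$ for $z\ne0$. $\|\cdot\|$ is any matrix norm. *)

theory Defs
  imports "HOL-Analysis.Analysis" "Jordan_Normal_Form.Gauss_Jordan_Elimination"
begin

unbundle no vec_syntax
no_notation Inner_Product.real_inner_class.inner (infix \<open>\<bullet>\<close> 70)

text \<open>Vectors and matrices are those of \<^theory>\<open>Jordan_Normal_Form.Matrix\<close>; all indices run from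
  \<open>0\<close>, so the entry written \<open>b\<^sub>j\<close> with \<open>1 \<le> j \<le> q\<close> on paper is \<open>b $ (j - 1)\<close>.\<close>

definition ones_vec :: "nat \<Rightarrow> complex vec" where
  "ones_vec n = Matrix.vec n (\<lambda>_. 1)"

definition Gamma_vec :: "complex vec \<Rightarrow> complex" where
  "Gamma_vec v = (\<Prod>h<dim_vec v. Gamma (v $ h))"

definition matrix_norm :: "nat \<Rightarrow> nat \<Rightarrow> (complex mat \<Rightarrow> real) \<Rightarrow> bool" where
  "matrix_norm m n N \<longleftrightarrow>
     (\<forall>A\<in>carrier_mat m n. 0 \<le> N A \<and> (N A = 0 \<longleftrightarrow> A = 0\<^sub>m m n)) \<and>
     (\<forall>A\<in>carrier_mat m n. \<forall>s. N (s \<cdot>\<^sub>m A) = cmod s * N A) \<and>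
     (\<forall>A\<in>carrier_mat m n. \<forall>B\<in>carrier_mat m n. N (A + B) \<le> N A + N B)"

subsection \<open>Complex measures\<close>

text \<open>A complex Borel measure is given by its set function. Every complex measure has the form
  \<open>\<nu>(A) = \<integral>\<^sub>A f dM\<close> with a finite positive measure \<open>M\<close> (for instance its total variation) and an
  \<open>M\<close>-integrable \<open>f\<close>, and then \<open>\<integral>\<^sub>S \<phi> d\<nu> = \<integral>\<^sub>S \<phi> f dM\<close>. The value does not depend on the choice of
  \<open>M\<close> and \<open>f\<close>; see \<open>cm_has_integral_unique\<close> below.\<close>

definition cm_has_integral ::
  "('a::topological_space set \<Rightarrow> complex) \<Rightarrow> 'a set \<Rightarrow> ('a \<Rightarrow> complex) \<Rightarrow> complex \<Rightarrow> bool" where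
  "cm_has_integral \<nu> S \<phi> I \<longleftrightarrow>
     set_borel_measurable borel S \<phi> \<and>
     (\<exists>M f. finite_measure M \<and> sets M = sets borel \<and> integrable M f \<and>
        (\<forall>A\<in>sets borel. \<nu> A = (LINT x:A|M. f x)) \<and>
        set_integrable M S (\<lambda>x. \<phi> x * f x) \<and> I = (LINT x:S|M. \<phi> x * f x))"

definition cm_integral ::
  "('a::topological_space set \<Rightarrow> complex) \<Rightarrow> 'a set \<Rightarrow> ('a \<Rightarrow> complex) \<Rightarrow> complex" where
  "cm_integral \<nu> S \<phi> = (THE I. cm_has_integral \<nu> S \<phi> I)"

definition cm_push_forward :: "('a \<Rightarrow> 'b) \<Rightarrow> ('a set \<Rightarrow> complex) \<Rightarrow> 'b set \<Rightarrow> complex" where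
  "cm_push_forward h \<nu> B = \<nu> (h -` B)"

text \<open>The product of a matrix of complex measures with a complex matrix.\<close>

definition cm_mat_mult :: "('a set \<Rightarrow> complex) mat \<Rightarrow> complex mat \<Rightarrow> ('a set \<Rightarrow> complex) mat" where
  "cm_mat_mult J D = Matrix.mat (dim_row J) (dim_col D)
     (\<lambda>(j,i). \<lambda>A. \<Sum>k<dim_col J. (J $$ (j,k)) A * D $$ (k,i))"

lemma cm_simple_integral:
  fixes f :: "'a::topological_space \<Rightarrow> complex"
  assumes "sets M = sets borel" "integrable M f"
    and "\<And>A. A \<in> sets borel \<Longrightarrow> \<nu> A = (LINT x:A|M. f x)"
    and s: "simple_function borel s"
  shows "(LINT x|M. s x * f x) = (\<Sum>y\<in>range s. y * \<nu> (s -` {y}))"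
proof -
  have fin: "finite (range s)" and ms: "\<And>y. s -` {y} \<in> sets borel"
  proof -
    show "finite (range s)" using s by (auto simp: simple_function_def)
    show "s -` {y} \<in> sets borel" for y
    proof (cases "y \<in> range s")
      case True
      then show ?thesis using s by (auto simp: simple_function_def)
    next
      case False
      then have "s -` {y} = {}" by auto
      then show ?thesis by simp
    qed
  qed
  have *: "s x * f x = (\<Sum>y\<in>range s. y * (indicator (s -` {y}) x *\<^sub>R f x))" for x
  proof -
    have "(\<Sum>y\<in>range s. y * (indicator (s -` {y}) x *\<^sub>R f x)) =
          (\<Sum>y\<in>range s. if y = s x then y * f x else 0)"
      by (intro sum.cong) (auto simp: indicator_def)
    then show ?thesis using fin by (simp add: sum.delta')
  qed
  have int: "integrable M (\<lambda>x. indicator (s -` {y}) x *\<^sub>R f x)" for y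
    using assms(1,2) ms by (intro integrable_mult_indicator) auto
  have "(LINT x|M. s x * f x) =
      (\<Sum>y\<in>range s. LINT x|M. y * (indicator (s -` {y}) x *\<^sub>R f x))"
    unfolding * by (intro Bochner_Integration.integral_sum integrable_mult_right int)
  also have "\<dots> = (\<Sum>y\<in>range s. y * \<nu> (s -` {y}))"
    unfolding assms(3)[OF ms] set_lebesgue_integral_def by (simp only: integral_mult_right_zero)
  finally show ?thesis .
qed

lemma cm_has_integral_unique:
  assumes "cm_has_integral \<nu> S \<phi> I" "cm_has_integral \<nu> S \<phi> I'"
  shows "I = I'"
proof -
  define \<psi> where "\<psi> = (\<lambda>x. indicator S x *\<^sub>R \<phi> x)"
  have \<psi>: "\<psi> \<in> borel_measurable borel"
    using assms(1) by (auto simp: cm_has_integral_def set_borel_measurable_def \<psi>_def)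
  obtain s where s: "\<And>i::nat. simple_function borel (s i)"
      "\<And>x. x \<in> space borel \<Longrightarrow> (\<lambda>i. s i x) \<longlonglongrightarrow> \<psi> x"
      "\<And>i x. x \<in> space borel \<Longrightarrow> dist (s i x) 0 \<le> 2 * dist (\<psi> x) 0"
    using borel_measurable_implies_sequence_metric[OF \<psi>, of 0] by metis
  have lim: "(\<lambda>i. \<Sum>y\<in>range (s i). y * \<nu> (s i -` {y})) \<longlonglongrightarrow> J"
    if J: "cm_has_integral \<nu> S \<phi> J" for J
  proof -
    obtain M f where M: "sets M = sets borel" "integrable M f"
        "\<And>A. A \<in> sets borel \<Longrightarrow> \<nu> A = (LINT x:A|M. f x)"
        "set_integrable M S (\<lambda>x. \<phi> x * f x)" "J = (LINT x:S|M. \<phi> x * f x)"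
      using J unfolding cm_has_integral_def by blast
    have eq: "indicator S x *\<^sub>R (\<phi> x * f x) = \<psi> x * f x" for x
      by (simp add: \<psi>_def)
    have int: "integrable M (\<lambda>x. \<psi> x * f x)" and JI: "J = (LINT x|M. \<psi> x * f x)"
      using M(4,5) by (simp_all add: set_integrable_def set_lebesgue_integral_def eq)
    have ms: "s i \<in> borel_measurable M" for i
      using borel_measurable_simple_function[OF s(1)] M(1) measurable_cong_sets by blast
    have "(\<lambda>i. LINT x|M. s i x * f x) \<longlonglongrightarrow> (LINT x|M. \<psi> x * f x)"
    proof (rule integral_dominated_convergence[where w="\<lambda>x. 2 * norm (\<psi> x * f x)"])
      show "AE x in M. norm (s i x * f x) \<le> 2 * norm (\<psi> x * f x)" for i
        using s(3)[of _ i] by (auto simp: norm_mult mult.assoc[symmetric] intro!: mult_right_mono)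
      show "AE x in M. (\<lambda>i. s i x * f x) \<longlonglongrightarrow> \<psi> x * f x"
        using s(2) by (auto intro!: tendsto_intros)
    qed (use ms M(2) int in \<open>auto intro!: borel_measurable_times\<close>)
    then show ?thesis
      unfolding JI using cm_simple_integral[OF M(1-3) s(1)] by simp
  qed
  show ?thesis
    using lim[OF assms(1)] lim[OF assms(2)] by (rule LIMSEQ_unique)
qed

lemma cm_integral_eq: "cm_has_integral \<nu> S \<phi> I \<Longrightarrow> cm_integral \<nu> S \<phi> = I"
  unfolding cm_integral_def using cm_has_integral_unique by blast

subsection \<open>Limit matrices\<close>

definition limit_W :: "complex vec \<Rightarrow> complex vec \<Rightarrow> complex vec \<Rightarrow> complex \<Rightarrow> complex mat" where
  "limit_W a b \<kappa> z = (let r = dim_vec a; q = dim_vec b; p = dim_vec \<kappa> in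
     Matrix.mat q p (\<lambda>(j,i). \<Sum>k.
       Gamma_vec ((of_nat k + \<kappa> $ i) \<cdot>\<^sub>v ones_vec r + a + ones_vec r) /
       Gamma_vec ((of_nat k + \<kappa> $ i) \<cdot>\<^sub>v ones_vec q + b + unit_vec q j + ones_vec q) * z ^ k))"

definition limit_C :: "complex vec \<Rightarrow> complex vec \<Rightarrow> complex vec \<Rightarrow> complex \<Rightarrow> complex mat" where
  "limit_C a b \<kappa> z = (1 / z) \<cdot>\<^sub>m limit_W a b \<kappa> (1 / z)"

subsection \<open>The Jacobi-like matrix measure\<close>

definition beta_kernel :: "complex \<Rightarrow> complex \<Rightarrow> real \<Rightarrow> complex" where
  "beta_kernel u v x = of_real x powr u * of_real (1 - x) powr (v - u - 1) / Gamma (v - u)"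

definition mellin_conv :: "(real \<Rightarrow> complex) \<Rightarrow> (real \<Rightarrow> complex) \<Rightarrow> real \<Rightarrow> complex" where
  "mellin_conv f g x = (LINT t:{x<..<1}|lborel. f t * g (x / t) / of_real t)"

text \<open>\<open>mellin_convs F n\<close> is \<open>F 0 * \<cdots> * F n\<close>, bracketed to the left.\<close>

fun mellin_convs :: "(nat \<Rightarrow> real \<Rightarrow> complex) \<Rightarrow> nat \<Rightarrow> real \<Rightarrow> complex" where
  "mellin_convs F 0 = F 0"
| "mellin_convs F (Suc n) = mellin_conv (mellin_convs F n) (F (Suc n))"

text \<open>The parameter \<open>l\<close> is the vector written \<open>\<lambda>\<close> on paper; the concatenation \<open>a @\<^sub>v l\<close> is \<open>\<alpha>\<close>.\<close>

definition jacobi_weight :: "complex vec \<Rightarrow> complex vec \<Rightarrow> complex vec \<Rightarrow> nat \<Rightarrow> real \<Rightarrow> complex" where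
  "jacobi_weight a b l j =
     mellin_convs (\<lambda>h. beta_kernel ((a @\<^sub>v l) $ h) (b $ h + (if j = h then 1 else 0)))
       (dim_vec b - 1)"

definition jacobi_measure ::
  "complex vec \<Rightarrow> complex vec \<Rightarrow> complex vec \<Rightarrow> complex vec \<Rightarrow> (real set \<Rightarrow> complex) mat" where
  "jacobi_measure a b \<kappa> l = Matrix.mat (dim_vec b) (dim_vec \<kappa>)
     (\<lambda>(j,i). \<lambda>A. LINT x:A \<inter> {0<..<1}|lborel. jacobi_weight a b l j x * of_real x powr (\<kappa> $ i))"

subsection \<open>Rescaling\<close>

definition lam :: "real vec \<Rightarrow> real \<Rightarrow> complex vec" where
  "lam c T = Matrix.vec (dim_vec c) (\<lambda>h. of_real (c $ h) + \<i> * of_real T)"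

definition Lam :: "complex vec \<Rightarrow> complex" where
  "Lam l = (\<Prod>h<dim_vec l. l $ h)"

definition D_mat :: "complex vec \<Rightarrow> complex vec \<Rightarrow> complex mat" where
  "D_mat \<kappa> l = mat_diag (dim_vec \<kappa>) (\<lambda>i. \<Prod>h<dim_vec l. Gamma (l $ h + \<kappa> $ i + 1))"

definition Delta :: "complex vec \<Rightarrow> complex set" where
  "Delta l = (\<lambda>x. of_real x / Lam l) ` {0..1}"

definition rescaled_measure ::
  "complex vec \<Rightarrow> complex vec \<Rightarrow> complex vec \<Rightarrow> complex vec \<Rightarrow> (complex set \<Rightarrow> complex) mat" where
  "rescaled_measure a b \<kappa> l = map_mat (cm_push_forward (\<lambda>x. of_real x / Lam l))
     (cm_mat_mult (jacobi_measure a b \<kappa> l) (the (mat_inverse (D_mat \<kappa> l))))"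

definition C_hat ::
  "complex vec \<Rightarrow> complex vec \<Rightarrow> complex vec \<Rightarrow> complex vec \<Rightarrow> complex \<Rightarrow> complex mat" where
  "C_hat a b \<kappa> l z =
     map_mat (\<lambda>\<nu>. cm_integral \<nu> (Delta l) (\<lambda>y. 1 / (z - y))) (rescaled_measure a b \<kappa> l)"

definition W_hat ::
  "complex vec \<Rightarrow> complex vec \<Rightarrow> complex vec \<Rightarrow> complex vec \<Rightarrow> complex \<Rightarrow> complex mat" where
  "W_hat a b \<kappa> l z =
     map_mat (\<lambda>\<nu>. cm_integral \<nu> (Delta l) (\<lambda>y. 1 / (1 - y * z))) (rescaled_measure a b \<kappa> l)"

text \<open>Finiteness of all Gamma factors occurring in the definitions above. HOL's \<^const>\<open>Gamma\<close> is total,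
  with value \<open>0\<close> at its poles. Under the standing inequalities this condition is automatic; see
  \<open>gamma_factors_finite_lam\<close> below.\<close>

definition gamma_factors_finite ::
  "complex vec \<Rightarrow> complex vec \<Rightarrow> complex vec \<Rightarrow> complex vec \<Rightarrow> bool" where
  "gamma_factors_finite a b \<kappa> l \<longleftrightarrow>
     (\<forall>k i h. i < dim_vec \<kappa> \<longrightarrow> h < dim_vec a \<longrightarrow>
        of_nat k + \<kappa> $ i + a $ h + 1 \<notin> \<int>\<^sub>\<le>\<^sub>0) \<and>
     (\<forall>k i j h. i < dim_vec \<kappa> \<longrightarrow> j < dim_vec b \<longrightarrow> h < dim_vec b \<longrightarrow>
        of_nat k + \<kappa> $ i + b $ h + (if j = h then 1 else 0) + 1 \<notin> \<int>\<^sub>\<le>\<^sub>0) \<and>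
     (\<forall>j h. j < dim_vec b \<longrightarrow> h < dim_vec b \<longrightarrow>
        b $ h + (if j = h then 1 else 0) - (a @\<^sub>v l) $ h \<notin> \<int>\<^sub>\<le>\<^sub>0) \<and>
     (\<forall>i h. i < dim_vec \<kappa> \<longrightarrow> h < dim_vec l \<longrightarrow> l $ h + \<kappa> $ i + 1 \<notin> \<int>\<^sub>\<le>\<^sub>0)"

lemma gamma_factors_finite_lam:
  fixes a b \<kappa> :: "complex vec" and c :: "real vec"
  assumes dims: "r < q" "a \<in> carrier_vec r" "b \<in> carrier_vec q" "\<kappa> \<in> carrier_vec p"
      "c \<in> carrier_vec (q - r)"
    and ab: "\<And>h. h < r \<Longrightarrow> Re (b $ h - a $ h) > 0"
    and \<kappa>a: "\<And>i h. i < p \<Longrightarrow> h < r \<Longrightarrow> Re (\<kappa> $ i + a $ h + 1) > 0"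
    and c1: "\<And>h. h < q - r \<Longrightarrow> max (-1) (MAX i\<in>{..<p}. -1 - Re (\<kappa> $ i)) < c $ h"
    and c2: "\<And>h. h < q - r \<Longrightarrow> c $ h < Re (b $ (r + h))"
  shows "gamma_factors_finite a b \<kappa> (lam c T)"
proof -
  have pos: "w \<notin> \<int>\<^sub>\<le>\<^sub>0" if "Re w > 0" for w :: complex
    using that by (auto elim!: nonpos_Ints_cases)
  have \<kappa>c: "Re (\<kappa> $ i) + c $ h + 1 > 0" if "i < p" "h < q - r" for i h
  proof -
    have "-1 - Re (\<kappa> $ i) \<le> (MAX i\<in>{..<p}. -1 - Re (\<kappa> $ i))"
      using that by (intro Max_ge) auto
    with c1[OF that(2)] show ?thesis by linarith
  qed
  have \<kappa>b: "Re (\<kappa> $ i) + Re (b $ h) + 1 > 0" if "i < p" "h < q" for i h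
  proof (cases "h < r")
    case True
    then show ?thesis using ab[of h] \<kappa>a[OF that(1), of h] by simp
  next
    case False
    then have "h - r < q - r" "r + (h - r) = h" using that by auto
    then show ?thesis using \<kappa>c[OF that(1), of "h - r"] c2[of "h - r"] by simp
  qed
  have \<alpha>: "Re (b $ h - (a @\<^sub>v lam c T) $ h) > 0" if "h < q" for h
  proof (cases "h < r")
    case True
    then show ?thesis using ab[of h] dims by (simp add: lam_def)
  next
    case False
    then show ?thesis using c2[of "h - r"] that dims by (simp add: lam_def)
  qed
  show ?thesis
    unfolding gamma_factors_finite_def
  proof (intro conjI allI impI; rule pos)
    fix k i h assume "i < dim_vec \<kappa>" "h < dim_vec a"
    then show "Re (of_nat k + \<kappa> $ i + a $ h + 1) > 0"
      using \<kappa>a[of i h] dims by simp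
  next
    fix k i j h assume "i < dim_vec \<kappa>" "h < dim_vec b"
    then show "Re (of_nat k + \<kappa> $ i + b $ h + (if j = h then 1 else 0) + 1) > 0"
      using \<kappa>b[of i h] dims by simp
  next
    fix j h assume "h < dim_vec b"
    then show "Re (b $ h + (if j = h then 1 else 0) - (a @\<^sub>v lam c T) $ h) > 0"
      using \<alpha>[of h] dims by simp
  next
    fix i h assume "i < dim_vec \<kappa>" "h < dim_vec (lam c T)"
    then show "Re (lam c T $ h + \<kappa> $ i + 1) > 0"
      using \<kappa>c[of i h] dims by (simp add: lam_def)
  qed
qed

end

theory Submission
  imports Defs "HOL-Real_Asymp.Real_Asymp"
begin

text \<open>Mellin convolution multiplies moments, and the moments of the beta kernels are quotients of
  Gamma values, so the \<open>k\<close>-th Taylor coefficient of the rescaled Stieltjes transform is the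
  \<open>k\<close>-th coefficient of \<open>W\<close> times \<open>\<Prod>\<^sub>h (\<lambda>\<^sub>h + \<kappa>\<^sub>i + 1)\<^sub>k / \<lambda>\<^sub>h\<^sup>k\<close>. Each of these factors tends
  to 1. For \<open>\<bar>\<lambda>\<^sub>h\<bar> \<ge> B\<close> their product is at most \<open>(\<Prod>\<^bsub>m<k\<^esub> (1 + (\<bar>\<kappa>\<^sub>i + 1\<bar> + m) / B))\<^sup>d\<close>, of order
  \<open>(k! / B\<^sup>k)\<^sup>d\<close> up to powers of \<open>k\<close>; the coefficients of \<open>W\<close> decay like \<open>(k!)\<^sup>-\<^sup>d\<close>, so the ratio
  test gives a majorant on \<open>\<bar>z\<bar> \<le> R\<close> as soon as \<open>B\<^sup>d > R\<close>, and Tannery's theorem applies.\<close>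

subsection \<open>Moments and Mellin convolution\<close>

lemma borel_measurable_of_real_powr [measurable]:
  "(\<lambda>x. complex_of_real x powr s) \<in> borel_measurable borel"
proof -
  \<comment> \<open>On each open half-line the principal logarithm is
    \<open>ln \<bar>x\<bar>\<close> plus a constant, 0 or \<open>\<i> * pi\<close>, and
    \<open>0 powr s = 0\<close>; in this case form measurability is evident.\<close>
  have eq: "complex_of_real x powr s = (if x = 0 then 0 else
      exp (s * (of_real (ln \<bar>x\<bar>) + (if x < 0 then of_real pi else 0) * \<i>)))" for x
    using Ln_Reals_eq[of "of_real x"] Ln_of_real[of x] Ln_of_real'[of x]
    by (auto simp: powr_def mult_ac)
  show ?thesis unfolding eq by measurable
qed

lemma Gamma_ne_0_Re_pos: "Re z > 0 \<Longrightarrow> Gamma (z :: complex) \<noteq> 0"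
  by (auto simp: Gamma_eq_zero_iff elim!: nonpos_Ints_cases)

text \<open>The modulus of a complex power of a positive real depends only on the real part of the
  exponent, so the real Beta integrand dominates.\<close>

lemma integrable_complex_Beta:
  assumes "Re a > 0" "Re b > 0"
  shows "integrable lborel (\<lambda>x. indicator {0<..<1} x *\<^sub>R
           (complex_of_real x powr (a - 1) * of_real (1 - x) powr (b - 1)))"
proof (rule Bochner_Integration.integrable_bound)
  show "integrable lborel (\<lambda>x. indicator {0..1} x *\<^sub>R (x powr (Re a - 1) * (1 - x) powr (Re b - 1)))"
    using integrable_Beta[OF assms] by (simp add: set_integrable_def)
  show "AE x in lborel. norm (indicator {0<..<1} x *\<^sub>R
           (complex_of_real x powr (a - 1) * of_real (1 - x) powr (b - 1)))
     \<le> norm (indicator {0..1} x *\<^sub>R (x powr (Re a - 1) * (1 - x) powr (Re b - 1)))"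
    by (intro AE_I2) (auto simp: indicator_def norm_mult norm_powr_real_powr)
qed measurable

text \<open>Euler's integral is restated as a Bochner integral over \<open>lborel\<close>, the form
  to which Fubini applies.\<close>

lemma has_bochner_integral_Gamma:
  assumes "Re a > 0"
  shows "has_bochner_integral lborel
     (\<lambda>x. indicator {0<..} x *\<^sub>R (complex_of_real x powr (a - 1) * of_real (exp (- x)))) (Gamma a)"
proof -
  have eq: "complex_of_real x powr (a - 1) * of_real (exp (- x)) =
     of_real x powr (a - 1) / of_real (exp x)" for x
    by (simp add: exp_minus divide_inverse flip: of_real_exp)
  have "set_integrable lebesgue {0<..} (\<lambda>x. complex_of_real x powr (a - 1) * of_real (exp (- x)))"
    unfolding eq using absolutely_integrable_Gamma_integral'[OF assms] .
  \<comment> \<open>Borel measurability of the integrand allows the passage from the completed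
    measure to \<open>lborel\<close>.\<close>
  then have int: "set_integrable lborel {0<..} (\<lambda>x. complex_of_real x powr (a - 1) * of_real (exp (- x)))"
    unfolding set_integrable_def by (subst (asm) integrable_completion) (measurable; simp)+
  have "(LINT x:{0<..}|lborel. complex_of_real x powr (a - 1) * of_real (exp (- x))) = Gamma a"
    using set_borel_integral_eq_integral(2)[OF int] Gamma_integral_complex'[OF assms]
    unfolding eq by (simp add: integral_unique)
  then show ?thesis
    using int unfolding has_bochner_integral_iff set_integrable_def set_lebesgue_integral_def by simp
qed

text \<open>With \<open>g\<^sub>a(x) = x\<^sup>a\<^sup>-\<^sup>1 e\<^sup>-\<^sup>x\<close> on \<open>x > 0\<close>, the additive convolution of \<open>g\<^sub>a\<close> and \<open>g\<^sub>b\<close> is the Beta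
  integral times \<open>g\<^sub>a\<^sub>+\<^sub>b\<close>; integrate both sides.\<close>

lemma has_bochner_integral_complex_Beta:
  assumes "Re a > 0" "Re b > 0"
  shows "has_bochner_integral lborel (\<lambda>x. indicator {0<..<1} x *\<^sub>R
           (complex_of_real x powr (a - 1) * of_real (1 - x) powr (b - 1))) (Beta a b)"
proof -
  define g where "g a x = indicator {0<..} x *\<^sub>R (complex_of_real x powr (a - 1) * of_real (exp (- x)))" for a x
  have [measurable]: "g a \<in> borel_measurable borel" for a
    unfolding g_def by measurable
  have g: "integrable lborel (g a)" "integral\<^sup>L lborel (g a) = Gamma a" if "Re a > 0" for a
    using has_bochner_integral_Gamma[OF that] unfolding g_def[symmetric] has_bochner_integral_iff by auto
  define I where "I = (LINT x|lborel. indicator {0<..<1} x *\<^sub>R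
           (complex_of_real x powr (a - 1) * of_real (1 - x) powr (b - 1)))"
  have shift: "integrable lborel (\<lambda>x. g b (x - t))" "(LINT x|lborel. g b (x - t)) = Gamma b"
       "(LINT x|lborel. norm (g b (x - t))) = (LINT x|lborel. norm (g b x))" for t
    using lborel_integrable_real_affine[OF g(1)[OF assms(2)], of 1 "-t"]
      lborel_integral_real_affine[of 1 "g b" "-t"] lborel_integral_real_affine[of 1 "\<lambda>x. norm (g b x)" "-t"]
      g(2)[OF assms(2)] by simp_all
  \<comment> \<open>Tonelli: by translation invariance the iterated integral of the norm is the
    product of the two L1 norms.\<close>
  have H: "integrable (lborel \<Otimes>\<^sub>M lborel) (\<lambda>(t, x). g a t * g b (x - t))"
  proof (rule lborel_pair.Fubini_integrable)
    show "AE t in lborel. integrable lborel (\<lambda>x. case (t, x) of (t, x) \<Rightarrow> g a t * g b (x - t))"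
      using shift(1) by simp
    have "(\<lambda>t. LINT x|lborel. norm (case (t, x) of (t, x) \<Rightarrow> g a t * g b (x - t))) =
        (\<lambda>t. norm (g a t) * (LINT x|lborel. norm (g b x)))"
      by (simp add: norm_mult shift(3))
    then show "integrable lborel (\<lambda>t. LINT x|lborel. norm (case (t, x) of (t, x) \<Rightarrow> g a t * g b (x - t)))"
      using g(1)[OF assms(1)] by simp
  qed measurable
  have inner: "(LINT t|lborel. g a t * g b (x - t)) = g (a + b) x * I" for x
  proof (cases "x > 0")
    case False
    \<comment> \<open>For \<open>x \<le> 0\<close> no \<open>t\<close> satisfies both
      \<open>t > 0\<close> and \<open>x - t > 0\<close>.\<close>
    then have "g a t * g b (x - t) = 0" for t by (simp add: g_def indicator_def)
    then have "(LINT t|lborel. g a t * g b (x - t)) = 0" by (simp only: integral_zero)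
    then show ?thesis using False by (simp add: g_def)
  next
    case True
    \<comment> \<open>The substitution \<open>t = x * y\<close>. The powers of \<open>x\<close>
      combine to the exponent \<open>a + b - 2\<close>; the Jacobian \<open>x\<close> then raises it
      to that of \<open>g (a + b)\<close>.\<close>
    have pt: "g a (x * y) * g b (x - x * y) = (of_real x powr (a + b - 2) * of_real (exp (- x))) *
       (indicator {0<..<1} y *\<^sub>R (complex_of_real y powr (a - 1) * of_real (1 - y) powr (b - 1)))" for y
    proof (cases "0 < y \<and> y < 1")
      case False
      then have "\<not> (0 < x * y \<and> 0 < x - x * y)" using True
        by (auto simp: zero_less_mult_iff)
      then show ?thesis using False by (auto simp: g_def indicator_def)
    next
      case y: True
      then have *: "0 < x * y" "0 < x - x * y" using True by auto
      have **: "x - x * y = x * (1 - y)" by (simp add: algebra_simps)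
      have e: "exp (- (x * y)) * exp (- (x * (1 - y))) = exp (- x)"
        by (simp flip: exp_add add: algebra_simps)
      have "complex_of_real (x * y) powr (a - 1) * of_real (x * (1 - y)) powr (b - 1)
          = of_real x powr (a + b - 2) * (of_real y powr (a - 1) * of_real (1 - y) powr (b - 1))"
      proof -
        have "a + b - 2 = (a - 1) + (b - 1)" by simp
        moreover have "complex_of_real (x * y) powr (a - 1) = of_real x powr (a - 1) * of_real y powr (a - 1)"
          using True y by (simp add: powr_times_real)
        moreover have "complex_of_real (x * (1 - y)) powr (b - 1) = of_real x powr (b - 1) * of_real (1 - y) powr (b - 1)"
          using True y powr_times_real[of "of_real x" "of_real (1 - y)" "b - 1"] by simp
        ultimately show ?thesis by (simp only: powr_add mult_ac)
      qed
      moreover have "g a (x * y) * g b (x - x * y) =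
          (complex_of_real (x * y) powr (a - 1) * of_real (x * (1 - y)) powr (b - 1)) *
          of_real (exp (- (x * y)) * exp (- (x * (1 - y))))"
        using * by (simp add: g_def ** del: of_real_exp)
      ultimately show ?thesis using y unfolding e by (simp add: mult_ac)
    qed
    have "(LINT t|lborel. g a t * g b (x - t)) = x *\<^sub>R (LINT y|lborel. g a (x * y) * g b (x - x * y))"
      using lborel_integral_real_affine[of x "\<lambda>t. g a t * g b (x - t)" 0] True by simp
    also have "\<dots> = of_real x * (of_real x powr (a + b - 2) * of_real (exp (- x))) * I"
      unfolding pt integral_mult_right_zero I_def[symmetric] by (simp add: scaleR_conv_of_real)
    also have "complex_of_real x * (of_real x powr (a + b - 2) * of_real (exp (- x))) = g (a + b) x"
    proof -
      have "complex_of_real x powr (a + b - 1) = of_real x powr (a + b - 2 + 1)" by simp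
      also have "\<dots> = of_real x powr (a + b - 2) * of_real x" unfolding powr_add using True by simp
      finally show ?thesis using True by (simp add: g_def)
    qed
    finally show ?thesis .
  qed
  have "Gamma a * Gamma b = (LINT t|lborel. LINT x|lborel. g a t * g b (x - t))"
    using g(2)[OF assms(1)] by (simp add: shift(2))
  also have "\<dots> = (LINT x|lborel. LINT t|lborel. g a t * g b (x - t))"
    using lborel_pair.Fubini_integral[OF H] by simp
  also have "\<dots> = Gamma (a + b) * I"
    unfolding inner using g(2)[of "a + b"] assms by simp
  finally have "Gamma (a + b) * I = Gamma a * Gamma b" by simp
  moreover have "Gamma (a + b) \<noteq> 0"
    using assms by (intro Gamma_ne_0_Re_pos) simp
  ultimately have "I = Beta a b" by (simp add: Beta_def field_simps)
  then show ?thesis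
    using integrable_complex_Beta[OF assms] by (simp add: has_bochner_integral_iff I_def)
qed

section \<open>Moments of beta kernels and Mellin convolutions\<close>

text \<open>This is the Mellin transform at \<open>s + 1\<close>, with absolute convergence.
  Measurability on the whole line is recorded separately because the integral sees \<open>f\<close>
  only on (0,1).\<close>

definition has_moment :: "(real \<Rightarrow> complex) \<Rightarrow> complex \<Rightarrow> complex \<Rightarrow> bool" where
  "has_moment f s m \<longleftrightarrow> f \<in> borel_measurable borel \<and>
     has_bochner_integral lborel (\<lambda>x. indicator {0<..<1} x *\<^sub>R (of_real x powr s * f x)) m"

lemma borel_measurable_beta_kernel [measurable]: "beta_kernel u v \<in> borel_measurable borel"
  unfolding beta_kernel_def[abs_def] by measurable

text \<open>Euler's Beta integral; the normalisation \<open>1 / Gamma (v - u)\<close> of the kernel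
  cancels one of its Gamma factors.\<close>

lemma has_moment_beta_kernel:
  assumes "Re (s + u + 1) > 0" "Re (v - u) > 0"
  shows "has_moment (beta_kernel u v) s (Gamma (s + u + 1) / Gamma (s + v + 1))"
proof -
  have ne: "Gamma (v - u) \<noteq> 0"
    by (rule Gamma_ne_0_Re_pos) fact
  have "has_bochner_integral lborel (\<lambda>x. (indicator {0<..<1} x *\<^sub>R
     (complex_of_real x powr (s + u + 1 - 1) * of_real (1 - x) powr (v - u - 1))) / Gamma (v - u))
     (Beta (s + u + 1) (v - u) / Gamma (v - u))"
    using has_bochner_integral_complex_Beta[OF assms] ne by (intro has_bochner_integral_divide) auto
  also have "(\<lambda>x. (indicator {0<..<1} x *\<^sub>R
     (complex_of_real x powr (s + u + 1 - 1) * of_real (1 - x) powr (v - u - 1))) / Gamma (v - u)) =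
     (\<lambda>x. indicator {0<..<1} x *\<^sub>R (of_real x powr s * beta_kernel u v x))"
    by (auto simp: beta_kernel_def indicator_def powr_add)
  also have "Beta (s + u + 1) (v - u) / Gamma (v - u) = Gamma (s + u + 1) / Gamma (s + v + 1)"
    using ne by (simp add: Beta_def algebra_simps)
  finally show ?thesis
    unfolding has_moment_def by simp
qed

text \<open>Let \<open>F\<close> and \<open>G\<close> be the two functions, cut to (0,1) and
  weighted by \<open>x powr s\<close>. The weight splits into the same power of \<open>t\<close>
  times that of \<open>x / t\<close>, so it passes through the convolution, and Fubini with the
  dilation by \<open>t\<close> separates the two integrals.\<close>

lemma has_moment_mellin_conv:
  assumes "has_moment f s m" "has_moment g s n"
  shows "has_moment (mellin_conv f g) s (m * n)"
proof -
  define F where "F x = indicator {0<..<1} x *\<^sub>R (of_real x powr s * f x)" for x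
  define G where "G x = indicator {0<..<1} x *\<^sub>R (of_real x powr s * g x)" for x
  have [measurable]: "f \<in> borel_measurable borel" "g \<in> borel_measurable borel"
    using assms by (auto simp: has_moment_def)
  have [measurable]: "F \<in> borel_measurable borel" "G \<in> borel_measurable borel"
    unfolding F_def G_def by measurable
  have F: "integrable lborel F" "integral\<^sup>L lborel F = m"
    and G: "integrable lborel G" "integral\<^sup>L lborel G = n"
    using assms unfolding has_moment_def F_def[symmetric] G_def[symmetric] has_bochner_integral_iff by auto
  \<comment> \<open>Dilation by \<open>t\<close> absorbs the factor \<open>1 / t\<close>, so the
    integral and the L1 norm of \<open>G\<close> are preserved.\<close>
  have scale: "integrable lborel (\<lambda>x. G (x / t) / of_real t)" "(LINT x|lborel. G (x / t) / of_real t) = n"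
       "(LINT x|lborel. norm (G (x / t) / of_real t)) = (LINT x|lborel. norm (G x))" if t: "t > 0" for t
  proof -
    show "integrable lborel (\<lambda>x. G (x / t) / of_real t)"
      using lborel_integrable_real_affine[OF G(1), of "1 / t" 0] t by simp
    show "(LINT x|lborel. G (x / t) / of_real t) = n"
      using lborel_integral_real_affine[of "1 / t" G 0] t G(2)
      by (simp add: scaleR_conv_of_real field_simps)
    show "(LINT x|lborel. norm (G (x / t) / of_real t)) = (LINT x|lborel. norm (G x))"
      using lborel_integral_real_affine[of "1 / t" "\<lambda>x. norm (G x)" 0] t
      by (simp add: norm_divide field_simps)
  qed
  \<comment> \<open>This confines the argument to positive dilations.\<close>
  have F0: "F t = 0" if "\<not> t > 0" for t using that by (simp add: F_def)
  have H: "integrable (lborel \<Otimes>\<^sub>M lborel) (\<lambda>(t, x). F t * (G (x / t) / of_real t))"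
  proof (rule lborel_pair.Fubini_integrable)
    have "integrable lborel (\<lambda>x. F t * (G (x / t) / of_real t))" for t
      using scale(1)[of t] F0[of t] by (cases "t > 0") (auto simp del: times_divide_eq_right)
    then show "AE t in lborel. integrable lborel (\<lambda>x. case (t, x) of (t, x) \<Rightarrow> F t * (G (x / t) / of_real t))"
      by simp
    have "(\<lambda>t. LINT x|lborel. norm (case (t, x) of (t, x) \<Rightarrow> F t * (G (x / t) / of_real t))) =
        (\<lambda>t. norm (F t) * (LINT x|lborel. norm (G x)))"
    proof
      fix t show "(LINT x|lborel. norm (case (t, x) of (t, x) \<Rightarrow> F t * (G (x / t) / of_real t))) =
        norm (F t) * (LINT x|lborel. norm (G x))"
        using scale(3)[of t] F0[of t] by (cases "t > 0") (simp_all add: norm_mult del: times_divide_eq_right)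
    qed
    then show "integrable lborel (\<lambda>t. LINT x|lborel. norm (case (t, x) of (t, x) \<Rightarrow> F t * (G (x / t) / of_real t)))"
      using F(1) by simp
  qed measurable
  have meas: "mellin_conv f g \<in> borel_measurable borel"
  proof -
    \<comment> \<open>The range of integration depends on \<open>x\<close>; written as an
      \<open>if\<close>, the integrand is jointly measurable in \<open>x\<close> and
      \<open>t\<close>.\<close>
    have "(\<lambda>x. LINT t|lborel. (if x < t \<and> t < 1 then 1 else 0) *\<^sub>R (f t * g (x / t) / of_real t)) \<in> borel_measurable borel"
      by measurable
    also have "(\<lambda>x. LINT t|lborel. (if x < t \<and> t < 1 then 1 else 0) *\<^sub>R (f t * g (x / t) / of_real t)) = mellin_conv f g"
      unfolding mellin_conv_def[abs_def] set_lebesgue_integral_def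
      by (intro ext Bochner_Integration.integral_cong) (auto simp: indicator_def)
    finally show ?thesis .
  qed
  \<comment> \<open>Both factors can be nonzero only if 0 < x < t < 1, which gives the range of the
    convolution integral and the cut-off at (0,1) at once.\<close>
  have inner: "(LINT t|lborel. F t * (G (x / t) / of_real t)) =
      indicator {0<..<1} x *\<^sub>R (of_real x powr s * mellin_conv f g x)" for x
  proof (cases "x \<in> {0<..<1}")
    case False
    have "F t * (G (x / t) / of_real t) = 0" for t
      using False by (auto simp: F_def G_def indicator_def zero_less_divide_iff field_simps)
    then have "(LINT t|lborel. F t * (G (x / t) / of_real t)) = 0" by (simp only: integral_zero)
    then show ?thesis using False by simp
  next
    case True
    have pt: "F t * (G (x / t) / of_real t) =
      of_real x powr s * (indicator {x<..<1} t *\<^sub>R (f t * g (x / t) / of_real t))" for t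
    proof (cases "x < t \<and> t < 1")
      case False
      then show ?thesis using True by (auto simp: F_def G_def indicator_def field_simps)
    next
      case t: True
      have "complex_of_real x powr s = of_real (t * (x / t)) powr s" using t True by simp
      also have "\<dots> = of_real t powr s * of_real (x / t) powr s"
        using t True powr_times_real[of "of_real t" "of_real (x / t)" s] by simp
      finally show ?thesis using t True by (simp add: F_def G_def indicator_def)
    qed
    show ?thesis
      unfolding pt integral_mult_right_zero using True
      by (simp add: mellin_conv_def set_lebesgue_integral_def)
  qed
  have int: "integrable lborel (\<lambda>x. indicator {0<..<1} x *\<^sub>R (of_real x powr s * mellin_conv f g x))"
    using lborel_pair.integrable_snd[OF H] unfolding inner .
  have "(LINT x|lborel. indicator {0<..<1} x *\<^sub>R (of_real x powr s * mellin_conv f g x)) =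
      (LINT t|lborel. LINT x|lborel. F t * (G (x / t) / of_real t))"
    unfolding inner[symmetric] using lborel_pair.Fubini_integral[OF H] by simp
  also have "\<dots> = (LINT t|lborel. F t * n)"
  proof (rule Bochner_Integration.integral_cong)
    fix t show "(LINT x|lborel. F t * (G (x / t) / of_real t)) = F t * n"
      using scale(2)[of t] F0[of t] by (cases "t > 0") (auto simp only: integral_mult_right_zero, auto)
  qed simp
  also have "\<dots> = m * n" using F(2) by simp
  finally show ?thesis
    using int meas unfolding has_moment_def has_bochner_integral_iff by simp
qed

lemma has_moment_mellin_convs:
  assumes "\<And>h. h \<le> n \<Longrightarrow> has_moment (F h) s (m h)"
  shows "has_moment (mellin_convs F n) s (\<Prod>h\<le>n. m h)"
  using assms by (induction n) (auto intro!: has_moment_mellin_conv)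


text \<open>Expand \<open>1 / (1 - x * w)\<close> geometrically. On (0,1) the partial sums are
  dominated by the integrable function \<open>norm (F x) / (1 - norm w)\<close>, so termwise
  integration is justified by dominated convergence.\<close>

lemma has_moment_geometric_series:
  assumes "\<And>k. has_moment f (s + of_nat k) (m k)" and "norm w < 1"
  defines "g \<equiv> \<lambda>x. indicator {0<..<1} x *\<^sub>R (of_real x powr s * f x / (1 - of_real x * w))"
  shows "integrable lborel g" and "(\<lambda>k. m k * w ^ k) sums integral\<^sup>L lborel g"
proof -
  define F where "F x = indicator {0<..<1} x *\<^sub>R (of_real x powr s * f x)" for x
  have mom: "has_bochner_integral lborel (\<lambda>x. of_real x ^ k * F x) (m k)" for k
  proof -
    have eq: "of_real x ^ k * F x = indicator {0<..<1} x *\<^sub>R (of_real x powr (s + of_nat k) * f x)" for x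
      by (auto simp: F_def indicator_def powr_add)
    show ?thesis unfolding eq using assms(1)[of k] by (simp add: has_moment_def)
  qed
  have F: "integrable lborel F" using mom[of 0] by (simp add: has_bochner_integral_iff)
  have [measurable]: "F \<in> borel_measurable borel"
    using borel_measurable_integrable[OF F] by simp
  have geq: "g x = F x / (1 - of_real x * w)" for x
    by (simp add: g_def F_def indicator_def)
  \<comment> \<open>Outside (0,1) the number \<open>x * w\<close> may be large, but there
    \<open>F\<close> vanishes.\<close>
  have w: "norm (of_real x * w) \<le> norm w" if "F x \<noteq> 0" for x :: real
  proof -
    have "0 < x" "x < 1" using that by (auto simp: F_def indicator_def split: if_splits)
    then show ?thesis by (simp add: norm_mult mult_left_le_one_le)
  qed
  define S where "S n x = (\<Sum>k<n. w ^ k * (of_real x ^ k * F x))" for n x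
  have SF: "S n x = F x * (\<Sum>k<n. (of_real x * w) ^ k)" for n x
    by (simp add: S_def sum_distrib_left power_mult_distrib mult_ac)
  have lim: "(\<lambda>n. S n x) \<longlonglongrightarrow> g x" for x
  proof (cases "F x = 0")
    case False
    then have "(\<lambda>k. (of_real x * w) ^ k) sums (1 / (1 - of_real x * w))"
      using w[OF False] assms(2) by (intro geometric_sums) simp
    then have "(\<lambda>n. F x * (\<Sum>k<n. (of_real x * w) ^ k)) \<longlonglongrightarrow> F x * (1 / (1 - of_real x * w))"
      by (intro tendsto_mult_left) (simp add: sums_def)
    then show ?thesis by (simp add: SF geq)
  qed (simp add: SF geq)
  have bound: "norm (S n x) \<le> norm (F x) * (1 / (1 - norm w))" for n x
  proof (cases "F x = 0")
    case False
    have "norm (\<Sum>k<n. (of_real x * w) ^ k) \<le> (\<Sum>k<n. norm w ^ k)"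
      using w[OF False] by (intro sum_norm_le) (auto simp only: norm_power intro!: power_mono norm_ge_zero)
    also have "\<dots> \<le> (\<Sum>k. norm w ^ k)"
      using assms(2) by (intro sum_le_suminf) auto
    also have "\<dots> = 1 / (1 - norm w)"
      using assms(2) by (intro suminf_geometric) auto
    finally show ?thesis unfolding SF norm_mult by (rule mult_left_mono) simp
  qed (simp add: SF)
  have Sint: "has_bochner_integral lborel (S n) (\<Sum>k<n. w ^ k * m k)" for n
    unfolding S_def[abs_def] by (intro has_bochner_integral_sum has_bochner_integral_mult_right mom)
  have gm: "g \<in> borel_measurable lborel"
    unfolding geq[abs_def] by measurable
  have Sm: "S n \<in> borel_measurable lborel" for n
    using Sint[of n] by (auto simp: has_bochner_integral_iff)
  have wi: "integrable lborel (\<lambda>x. norm (F x) * (1 / (1 - norm w)))" using F by auto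
  have l: "AE x in lborel. (\<lambda>n. S n x) \<longlonglongrightarrow> g x" using lim by simp
  have b: "AE x in lborel. norm (S n x) \<le> norm (F x) * (1 / (1 - norm w))" for n
    using bound by simp
  show "integrable lborel g"
    using integrable_dominated_convergence[OF gm Sm wi l b] .
  have "(\<lambda>n. integral\<^sup>L lborel (S n)) \<longlonglongrightarrow> integral\<^sup>L lborel g"
    using integral_dominated_convergence[OF gm Sm wi l b] .
  then show "(\<lambda>k. m k * w ^ k) sums integral\<^sup>L lborel g"
    using Sint by (simp add: has_bochner_integral_iff sums_def mult.commute)
qed

subsection \<open>Convergence of the coefficient series\<close>

text \<open>For parameters with positive real parts these are, up to a constant, the coefficients of
  the hypergeometric series {}_{r+1}F_q(1, \<alpha>; \<beta>; z).\<close>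

definition gamma_quotient :: "nat \<Rightarrow> nat \<Rightarrow> (nat \<Rightarrow> complex) \<Rightarrow> (nat \<Rightarrow> complex) \<Rightarrow> nat \<Rightarrow> complex" where
  "gamma_quotient r q \<alpha> \<beta> k = (\<Prod>h<r. Gamma (of_nat k + \<alpha> h)) / (\<Prod>h<q. Gamma (of_nat k + \<beta> h))"

text \<open>Ratio test: passing from \<open>k\<close> to \<open>Suc k\<close> multiplies the term by
  \<open>\<rho> k\<close>, where r + (q - r) factors linear in \<open>k\<close> stand against q such
  factors, so \<open>\<rho>\<close> tends to \<open>R / B ^ (q - r) < 1\<close>.\<close>

lemma summable_gamma_quotient:
  assumes "r < q" and \<alpha>: "\<And>h. h < r \<Longrightarrow> Re (\<alpha> h) > 0" and \<beta>: "\<And>h. h < q \<Longrightarrow> Re (\<beta> h) > 0"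
    and "R \<ge> 0" "A \<ge> 0" "B > 0" "R < B ^ (q - r)"
  shows "summable (\<lambda>k. norm (gamma_quotient r q \<alpha> \<beta> k) * R ^ k * (\<Prod>m<k. 1 + (A + real m) / B) ^ (q - r))"
    (is "summable ?u")
proof -
  define \<rho> where "\<rho> k = norm ((\<Prod>h<r. of_nat k + \<alpha> h) / (\<Prod>h<q. of_nat k + \<beta> h)) * R * (1 + (A + real k) / B) ^ (q - r)" for k
  have rec: "?u (Suc k) = \<rho> k * ?u k" for k
  proof -
    \<comment> \<open>A positive real part keeps the argument off the poles, so the functional
      equation applies.\<close>
    have G: "Gamma (of_nat (Suc k) + z) = (of_nat k + z) * Gamma (of_nat k + z)" if "Re z > 0" for z :: complex
    proof -
      have "of_nat k + z \<notin> \<int>\<^sub>\<le>\<^sub>0"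
      proof
        assume "of_nat k + z \<in> \<int>\<^sub>\<le>\<^sub>0"
        then obtain n where n: "of_nat k + z = of_int n" "n \<le> 0" by (auto elim!: nonpos_Ints_cases)
        from arg_cong[OF n(1), of Re] n(2) that show False by simp
      qed
      then show ?thesis using Gamma_plus1[of "of_nat k + z"] by (simp add: add_ac)
    qed
    have "gamma_quotient r q \<alpha> \<beta> (Suc k) =
       (\<Prod>h<r. of_nat k + \<alpha> h) / (\<Prod>h<q. of_nat k + \<beta> h) * gamma_quotient r q \<alpha> \<beta> k"
    proof -
      have "(\<Prod>h<r. Gamma (of_nat (Suc k) + \<alpha> h)) = (\<Prod>h<r. (of_nat k + \<alpha> h) * Gamma (of_nat k + \<alpha> h))"
        by (intro prod.cong refl G) (auto simp: \<alpha>)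
      moreover have "(\<Prod>h<q. Gamma (of_nat (Suc k) + \<beta> h)) = (\<Prod>h<q. (of_nat k + \<beta> h) * Gamma (of_nat k + \<beta> h))"
        by (intro prod.cong refl G) (auto simp: \<beta>)
      ultimately show ?thesis by (simp only: gamma_quotient_def prod.distrib times_divide_times_eq)
    qed
    then show ?thesis by (simp add: \<rho>_def norm_mult norm_divide power_mult_distrib mult_ac)
  qed
  have "\<rho> \<longlonglongrightarrow> norm ((\<Prod>h<r. 1) / (\<Prod>h<q. 1 :: complex)) * R * (1 / B) ^ (q - r)"
  proof (rule Lim_transform_eventually)
    have one: "(\<lambda>k. (of_nat k + z) / of_nat k) \<longlonglongrightarrow> 1" for z :: complex
    proof (rule Lim_transform_eventually)
      show "(\<lambda>k. 1 + z / of_nat k) \<longlonglongrightarrow> 1"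
        using tendsto_add[OF tendsto_const lim_const_over_n[of z], of 1] by simp
      show "\<forall>\<^sub>F k in sequentially. 1 + z / of_nat k = (of_nat k + z) / of_nat k"
        using eventually_gt_at_top[of 0] by eventually_elim (simp add: field_simps)
    qed
    have "(\<lambda>k. (1 + (A + real k) / B) / real k) \<longlonglongrightarrow> inverse B"
      using \<open>B > 0\<close> by real_asymp
    then have B: "(\<lambda>k. (1 + (A + real k) / B) / real k) \<longlonglongrightarrow> 1 / B"
      by (simp only: inverse_eq_divide)
    show "(\<lambda>k. norm ((\<Prod>h<r. (of_nat k + \<alpha> h) / of_nat k) / (\<Prod>h<q. (of_nat k + \<beta> h) / of_nat k)) * R *
        ((1 + (A + real k) / B) / real k) ^ (q - r))
      \<longlonglongrightarrow> norm ((\<Prod>h<r. 1) / (\<Prod>h<q. 1 :: complex)) * R * (1 / B) ^ (q - r)"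
      by (intro tendsto_intros one B) simp
    show "\<forall>\<^sub>F k in sequentially. norm ((\<Prod>h<r. (of_nat k + \<alpha> h) / of_nat k) / (\<Prod>h<q. (of_nat k + \<beta> h) / of_nat k)) * R *
        ((1 + (A + real k) / B) / real k) ^ (q - r) = \<rho> k"
      using eventually_gt_at_top[of 0]
    proof eventually_elim
      case (elim k)
      \<comment> \<open>Dividing every linear factor by \<open>k\<close> leaves the quotient
        unchanged, since q = r + (q - r).\<close>
      have "real k ^ q = real k ^ r * real k ^ (q - r)"
        using \<open>r < q\<close> by (simp flip: power_add)
      then show ?case
        using elim by (simp add: \<rho>_def prod_dividef norm_divide norm_mult norm_power power_divide)
    qed
  qed
  then have lim: "\<rho> \<longlonglongrightarrow> R / B ^ (q - r)" by (simp add: power_divide)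
  have "R / B ^ (q - r) < 1" using assms by simp
  then obtain \<theta> where \<theta>: "R / B ^ (q - r) < \<theta>" "\<theta> < 1" using dense by blast
  from order_tendstoD(2)[OF lim \<theta>(1)] obtain n where n: "\<And>k. k \<ge> n \<Longrightarrow> \<rho> k < \<theta>"
    by (auto simp: eventually_sequentially)
  show ?thesis
  proof (rule summable_ratio_test[OF \<theta>(2)])
    fix k assume "n \<le> k"
    have "\<rho> k \<ge> 0" using assms by (simp add: \<rho>_def)
    then have "norm (?u (Suc k)) = \<rho> k * norm (?u k)" unfolding rec by (simp only: real_norm_def abs_mult[of "\<rho> k"] abs_of_nonneg)
    also have "\<dots> \<le> \<theta> * norm (?u k)"
      using n[OF \<open>n \<le> k\<close>] by (intro mult_right_mono) auto
    finally show "norm (?u (Suc k)) \<le> \<theta> * norm (?u k)" .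
  qed
qed

section \<open>The correction factors and their limit\<close>

text \<open>The factor by which the rescaled moments differ from the coefficients of W;
  \<open>s\<close> will be \<kappa>_i + 1.\<close>

definition poch_ratio :: "nat \<Rightarrow> (nat \<Rightarrow> complex) \<Rightarrow> complex \<Rightarrow> nat \<Rightarrow> complex" where
  "poch_ratio d l s k = (\<Prod>h<d. pochhammer (l h + s) k / l h ^ k)"

text \<open>In this form both the limit 1 and the norm bound can be read off factor by
  factor.\<close>

lemma poch_ratio_eq:
  assumes "\<And>h. h < d \<Longrightarrow> l h \<noteq> 0"
  shows "poch_ratio d l s k = (\<Prod>h<d. \<Prod>m<k. 1 + (s + of_nat m) / l h)"
  unfolding poch_ratio_def
proof (rule prod.cong[OF refl])
  fix h assume "h \<in> {..<d}"
  then have "l h \<noteq> 0" using assms by simp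
  then have "1 + (s + of_nat m) / l h = (l h + s + of_nat m) / l h" for m
    by (simp add: field_simps)
  then show "pochhammer (l h + s) k / l h ^ k = (\<Prod>m<k. 1 + (s + of_nat m) / l h)"
    by (simp add: pochhammer_prod prod_dividef atLeast0LessThan)
qed

text \<open>Triangle inequality in each factor. The bound sees the \<open>l h\<close> only through
  their common lower bound \<open>B\<close>, so it serves all large T at once.\<close>

lemma norm_poch_ratio_le:
  assumes "B > 0" and l: "\<And>h. h < d \<Longrightarrow> norm (l h) \<ge> B"
  shows "norm (poch_ratio d l s k) \<le> (\<Prod>m<k. 1 + (norm s + real m) / B) ^ d"
proof -
  have "norm (1 + (s + of_nat m) / l h) \<le> 1 + (norm s + real m) / B" if "h < d" for h m
  proof -
    have "norm (1 + (s + of_nat m) / l h) \<le> 1 + norm (s + of_nat m) / norm (l h)"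
      using norm_triangle_ineq[of 1 "(s + of_nat m) / l h"] by (simp add: norm_divide)
    also have "\<dots> \<le> 1 + (norm s + real m) / B"
      using l[OF that] \<open>B > 0\<close> norm_triangle_ineq[of s "of_nat m"]
      by (intro add_left_mono frac_le) auto
    finally show ?thesis .
  qed
  moreover have "poch_ratio d l s k = (\<Prod>h<d. \<Prod>m<k. 1 + (s + of_nat m) / l h)"
    using assms by (intro poch_ratio_eq) fastforce
  ultimately have "norm (poch_ratio d l s k) \<le> (\<Prod>h<d. \<Prod>m<k. 1 + (norm s + real m) / B)"
    by (simp del: prod_constant flip: prod_norm) (intro prod_mono conjI prod_nonneg; simp)
  then show ?thesis by simp
qed

text \<open>For fixed \<open>k\<close> there are finitely many factors, each tending to 1. Control
  over all \<open>k\<close> together comes from the majorant.\<close>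

lemma tendsto_poch_ratio:
  assumes l: "\<And>T h. T > 0 \<Longrightarrow> h < d \<Longrightarrow> norm (l T h) \<ge> T"
  shows "((\<lambda>T. poch_ratio d (l T) s k) \<longlongrightarrow> 1) at_top"
proof (rule Lim_transform_eventually)
  have "((\<lambda>T. (s + of_nat m) / l T h) \<longlongrightarrow> 0) at_top" if "h < d" for h m
  proof (rule Lim_null_comparison)
    show "\<forall>\<^sub>F T in at_top. norm ((s + of_nat m) / l T h) \<le> norm (s + of_nat m) / T"
      using eventually_gt_at_top[of 0] 
    proof eventually_elim
      case (elim T)
      then show ?case
        using l[OF elim that] by (simp add: norm_divide frac_le)
    qed
    show "((\<lambda>T. norm (s + of_nat m) / T) \<longlongrightarrow> 0) at_top" by real_asymp
  qed
  then have "((\<lambda>T. \<Prod>h<d. \<Prod>m<k. 1 + (s + of_nat m) / l T h) \<longlongrightarrow> (\<Prod>h<d. \<Prod>m<k. 1 + 0)) at_top"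
    by (intro tendsto_prod tendsto_add tendsto_const) auto
  then show "((\<lambda>T. \<Prod>h<d. \<Prod>m<k. 1 + (s + of_nat m) / l T h) \<longlongrightarrow> 1) at_top" by simp
  show "\<forall>\<^sub>F T in at_top. (\<Prod>h<d. \<Prod>m<k. 1 + (s + of_nat m) / l T h) = poch_ratio d (l T) s k"
    using eventually_gt_at_top[of 0]
  proof eventually_elim
    case (elim T)
    then show ?case using l[of T] by (intro poch_ratio_eq[symmetric]) fastforce
  qed
qed

text \<open>Tannery's theorem for a weighted l1 distance between two coefficient sequences. This
  distance bounds the difference of the two power series on the whole disc of radius
  \<open>R\<close>.\<close>

lemma poch_ratio_series_convergence:
  fixes s :: complex and l :: "real \<Rightarrow> nat \<Rightarrow> complex"
  assumes "r < q" and \<alpha>: "\<And>h. h < r \<Longrightarrow> Re (\<alpha> h) > 0" and \<beta>: "\<And>h. h < q \<Longrightarrow> Re (\<beta> h) > 0"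
    and "R \<ge> 0" and l: "\<And>T h. T > 0 \<Longrightarrow> h < q - r \<Longrightarrow> norm (l T h) \<ge> T"
  defines "u \<equiv> \<lambda>T k. norm (gamma_quotient r q \<alpha> \<beta> k * (poch_ratio (q - r) (l T) s k - 1)) * R ^ k"
  shows "summable (\<lambda>k. norm (gamma_quotient r q \<alpha> \<beta> k) * R ^ k)"
    and "\<forall>\<^sub>F T in at_top. summable (u T)"
    and "((\<lambda>T. suminf (u T)) \<longlongrightarrow> 0) at_top"
proof -
  \<comment> \<open>This choice has \<open>B \<ge> 1\<close>, hence
    \<open>B ^ (q - r) \<ge> B > R\<close>, as the ratio test requires.\<close>
  define B where "B = R + 1"
  have B: "B > 0" "R < B ^ (q - r)"
  proof -
    show "B > 0" using \<open>R \<ge> 0\<close> by (simp add: B_def)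
    have "B ^ 1 \<le> B ^ (q - r)" using \<open>r < q\<close> \<open>R \<ge> 0\<close> by (intro power_increasing) (auto simp: B_def)
    then show "R < B ^ (q - r)" by (simp add: B_def)
  qed
  let ?P = "\<lambda>k. (\<Prod>m<k. 1 + (norm s + real m) / B) ^ (q - r)"
  let ?c = "\<lambda>k. norm (gamma_quotient r q \<alpha> \<beta> k) * R ^ k"
  have M: "summable (\<lambda>k. ?c k * ?P k)"
    using assms B by (intro summable_gamma_quotient) auto
  \<comment> \<open>Hence the majorant also dominates the plain coefficient series, and
    \<open>norm (ratio) + 1\<close> is at most \<open>2 * ?P k\<close>.\<close>
  have P1: "?P k \<ge> 1" for k
    using B by (intro one_le_power prod_ge_1) auto
  have c0: "?c k \<ge> 0" for k using \<open>R \<ge> 0\<close> by simp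
  show "summable ?c"
  proof (rule summable_comparison_test'[OF M])
    fix k show "norm (?c k) \<le> ?c k * ?P k"
      using mult_left_mono[OF P1 c0, of k k] c0[of k] by simp
  qed
  have bound: "u T k \<le> 2 * (?c k * ?P k)" if "T \<ge> B" for T k
  proof -
    have "norm (poch_ratio (q - r) (l T) s k - 1) \<le> norm (poch_ratio (q - r) (l T) s k) + 1"
      using norm_triangle_ineq4[of "poch_ratio (q - r) (l T) s k" 1] by simp
    also have "norm (poch_ratio (q - r) (l T) s k) \<le> ?P k"
      using that B l[of T] by (intro norm_poch_ratio_le) force+
    also have "?P k + 1 \<le> 2 * ?P k" using P1[of k] by simp
    finally have "?c k * norm (poch_ratio (q - r) (l T) s k - 1) \<le> ?c k * (2 * ?P k)"
      using c0 by (intro mult_left_mono) auto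
    then show ?thesis by (simp add: u_def norm_mult mult_ac)
  qed
  have u0: "u T k \<ge> 0" for T k using \<open>R \<ge> 0\<close> by (simp add: u_def)
  have lim: "((\<lambda>T. u T k) \<longlongrightarrow> 0) at_top" for k
  proof -
    have "((\<lambda>T. u T k) \<longlongrightarrow> norm (gamma_quotient r q \<alpha> \<beta> k * (1 - 1)) * R ^ k) at_top"
      unfolding u_def by (intro tendsto_intros tendsto_poch_ratio l)
    then show ?thesis by simp
  qed
  \<comment> \<open>The bound holds for all \<open>k\<close> as soon as \<open>T \<ge> B\<close>, a
    rectangle in the product filter.\<close>
  have ev: "\<forall>\<^sub>F (k, T) in at_top \<times>\<^sub>F at_top. norm (u T k) \<le> 2 * (?c k * ?P k)"
    unfolding eventually_prod_filter
  proof (intro exI conjI allI impI)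
    show "\<forall>\<^sub>F k :: nat in at_top. True" by simp
    show "\<forall>\<^sub>F T in at_top. T \<ge> B" by (rule eventually_ge_at_top)
    fix k :: nat and T assume "T \<ge> B"
    then show "case (k, T) of (k, T) \<Rightarrow> norm (u T k) \<le> 2 * (?c k * ?P k)"
      using bound[of T k] u0[of T k] by simp
  qed
  have sM: "summable (\<lambda>k. 2 * (?c k * ?P k))" using M by (rule summable_mult)
  from tannerys_theorem[OF lim ev sM trivial_limit_at_top_linorder]
  show "\<forall>\<^sub>F T in at_top. summable (u T)" "((\<lambda>T. suminf (u T)) \<longlongrightarrow> 0) at_top"
    using u0 by (auto simp: abs_of_nonneg)
qed

subsection \<open>Matrices and complex measures\<close>

text \<open>In finite dimension every norm is dominated by the largest entry: expand in the matrix
  units \<open>E x\<close> and take for \<open>C\<close> the sum of their norms.\<close>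

lemma matrix_norm_le_entries:
  assumes N: "matrix_norm m n N"
  obtains C where "C \<ge> 0"
    and "\<And>A e. A \<in> carrier_mat m n \<Longrightarrow> (\<And>j i. j < m \<Longrightarrow> i < n \<Longrightarrow> cmod (A $$ (j, i)) \<le> e) \<Longrightarrow> N A \<le> C * e"
proof -
  define E :: "nat \<times> nat \<Rightarrow> complex mat" where "E x = Matrix.mat m n (\<lambda>y. if y = x then 1 else 0)" for x
  define I where "I = {..<m} \<times> {..<n}"
  have fin: "finite I" by (simp add: I_def)
  have E: "E x \<in> carrier_mat m n" for x by (simp add: E_def)
  have E0: "N (E x) \<ge> 0" for x using N E by (auto simp: matrix_norm_def)
  have tri: "N (A + B) \<le> N A + N B" if "A \<in> carrier_mat m n" "B \<in> carrier_mat m n" for A B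
    using N that by (auto simp: matrix_norm_def)
  have scl: "N (s \<cdot>\<^sub>m A) = cmod s * N A" if "A \<in> carrier_mat m n" for s A
    using N that by (auto simp: matrix_norm_def)
  \<comment> \<open>Induction on the set \<open>S\<close> of positions whose entries have been kept;
    \<open>S = I\<close> recovers the whole matrix.\<close>
  have *: "N (Matrix.mat m n (\<lambda>y. if y \<in> S then A $$ y else 0)) \<le> (\<Sum>x\<in>S. cmod (A $$ x) * N (E x))"
    if "finite S" for S A
    using that
  proof induction
    case empty
    have "Matrix.mat m n (\<lambda>y. 0 :: complex) = 0\<^sub>m m n" by auto
    moreover have "N (0\<^sub>m m n) = 0" using N zero_carrier_mat unfolding matrix_norm_def by blast
    ultimately show ?case by simp
  next
    case (insert x S)
    have "Matrix.mat m n (\<lambda>y. if y \<in> insert x S then A $$ y else 0) =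
        A $$ x \<cdot>\<^sub>m E x + Matrix.mat m n (\<lambda>y. if y \<in> S then A $$ y else 0)"
      using insert.hyps by (intro eq_matI) (auto simp: E_def)
    also have "N \<dots> \<le> N (A $$ x \<cdot>\<^sub>m E x) + N (Matrix.mat m n (\<lambda>y. if y \<in> S then A $$ y else 0))"
      using E by (intro tri) auto
    also have "\<dots> \<le> cmod (A $$ x) * N (E x) + (\<Sum>x\<in>S. cmod (A $$ x) * N (E x))"
      using insert.IH by (simp add: scl[OF E])
    finally show ?case using insert.hyps by simp
  qed
  show ?thesis
  proof (rule that[of "\<Sum>x\<in>I. N (E x)"])
    show "(\<Sum>x\<in>I. N (E x)) \<ge> 0" by (intro sum_nonneg E0)
    fix A e assume A: "A \<in> carrier_mat m n" and e: "\<And>j i. j < m \<Longrightarrow> i < n \<Longrightarrow> cmod (A $$ (j, i)) \<le> e"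
    have "A = Matrix.mat m n (\<lambda>y. if y \<in> I then A $$ y else 0)"
      using A by (intro eq_matI) (auto simp: I_def)
    then have "N A \<le> (\<Sum>x\<in>I. cmod (A $$ x) * N (E x))" using *[OF fin, of A] by simp
    also have "\<dots> \<le> (\<Sum>x\<in>I. e * N (E x))"
      using e E0 by (intro sum_mono mult_right_mono) (auto simp: I_def)
    finally show "N A \<le> (\<Sum>x\<in>I. N (E x)) * e" by (simp add: sum_distrib_left mult.commute)
  qed
qed

text \<open>The elimination algorithm is not run: an explicit inverse excludes the result
  \<open>None\<close>, and uniqueness of inverses identifies the matrix returned.\<close>

lemma mat_inverse_mat_diag:
  fixes f :: "nat \<Rightarrow> 'a :: field"
  assumes f: "\<And>i. i < n \<Longrightarrow> f i \<noteq> 0"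
  shows "mat_inverse (mat_diag n f) = Some (mat_diag n (\<lambda>i. 1 / f i))"
proof -
  let ?A = "mat_diag n f" and ?B = "mat_diag n (\<lambda>i. 1 / f i)"
  have one: "mat_diag n g = 1\<^sub>m n" if "\<And>i. i < n \<Longrightarrow> g i = 1" for g :: "nat \<Rightarrow> 'a"
    using that by (intro eq_matI) (auto simp: mat_diag_def)
  have AB: "?A * ?B = 1\<^sub>m n" "?B * ?A = 1\<^sub>m n"
    unfolding mat_diag_diag using f by (auto intro!: one)
  show ?thesis
  proof (cases "mat_inverse ?A")
    case None
    have "?A \<in> Units (ring_mat TYPE('a) n ())"
      using AB by (auto simp: Units_def ring_mat_def intro!: bexI[of _ ?B])
    with mat_inverse(1)[OF mat_diag_dim None, where b = "()"] show ?thesis by blast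
  next
    case (Some C)
    from mat_inverse(2)[OF mat_diag_dim Some] have C: "?A * C = 1\<^sub>m n" "C \<in> carrier_mat n n" by auto
    have "C = (?B * ?A) * C" using C AB by simp
    also have "\<dots> = ?B * (?A * C)" using C by (intro assoc_mult_mat[of _ n n _ n _ n]) auto
    also have "\<dots> = ?B" unfolding C by (intro right_mult_one_mat[of _ n]) simp
    finally show ?thesis using Some by simp
  qed
qed

section \<open>Integration against a pushed-forward complex density\<close>

lemma cm_has_integral_push_forward:
  fixes L :: complex and g :: "real \<Rightarrow> complex"
  defines "h \<equiv> \<lambda>x. complex_of_real x / L"
  assumes "L \<noteq> 0" and [measurable]: "g \<in> borel_measurable borel" "\<phi> \<in> borel_measurable borel"
    and g: "set_integrable lborel {0<..<1} g"
    and \<phi>g: "set_integrable lborel {0<..<1} (\<lambda>x. \<phi> (h x) * g x)"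
    and \<nu>: "\<And>B. \<nu> B = (LINT x:(h -` B) \<inter> {0<..<1}|lborel. g x)"
  shows "cm_has_integral \<nu> (h ` {0..1}) \<phi> (LINT x:{0<..<1}|lborel. \<phi> (h x) * g x)"
proof -
  let ?M0 = "restrict_space lborel {0<..<1::real}"
  \<comment> \<open>The witnesses for the complex measure: \<open>M\<close> is the image of Lebesgue
    measure on (0,1), and \<open>f\<close> is the density carried along by
    \<open>Re (y * L)\<close>, a left inverse of \<open>h\<close> that is measurable on all of the
    plane.\<close>
  define M where "M = distr ?M0 borel h"
  define f where "f y = g (Re (y * L))" for y
  have fh: "f (h x) = g x" for x using \<open>L \<noteq> 0\<close> by (simp add: f_def h_def)
  have [measurable]: "f \<in> borel_measurable borel" unfolding f_def[abs_def] by measurable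
  have hb[measurable]: "h \<in> borel_measurable borel" unfolding h_def by measurable
  have h[measurable]: "h \<in> ?M0 \<rightarrow>\<^sub>M borel" by (intro measurable_restrict_space1) simp
  \<comment> \<open>The segment is a compact image, hence a Borel set.\<close>
  have cl: "closed (h ` {0..1})"
    unfolding h_def using \<open>L \<noteq> 0\<close> by (intro compact_imp_closed compact_continuous_image continuous_intros) auto
  then have S[measurable]: "h ` {0..1} \<in> sets borel" by simp
  have int: "integrable M F \<longleftrightarrow> set_integrable lborel {0<..<1} (\<lambda>x. F (h x))"
    if [measurable]: "F \<in> borel_measurable borel" for F :: "complex \<Rightarrow> complex"
    unfolding M_def set_integrable_def
    by (subst integrable_distr_eq[OF h that], subst integrable_restrict_space) auto
  have lint: "integral\<^sup>L M F = (LINT x:{0<..<1}|lborel. F (h x))"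
    if [measurable]: "F \<in> borel_measurable borel" for F :: "complex \<Rightarrow> complex"
    unfolding M_def set_lebesgue_integral_def
    by (subst integral_distr[OF h that], subst integral_restrict_space) auto
  have "finite_measure M"
    unfolding M_def by (intro finite_measure.finite_measure_distr h finite_measureI) (simp add: emeasure_restrict_space)
  moreover have "sets M = sets borel" by (simp add: M_def)
  moreover have "integrable M f" using g by (subst int) (auto simp: fh)
  moreover have "\<nu> A = (LINT x:A|M. f x)" if A[measurable]: "A \<in> sets borel" for A
  proof -
    have "(\<lambda>y. indicator A y *\<^sub>R f y) \<in> borel_measurable borel" by measurable
    from lint[OF this] show ?thesis
      unfolding \<nu> set_lebesgue_integral_def fh
      by (auto simp: indicator_def intro!: Bochner_Integration.integral_cong)
  qed
  moreover have "set_integrable M (h ` {0..1}) (\<lambda>x. \<phi> x * f x)"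
    and "(LINT x:{0<..<1}|lborel. \<phi> (h x) * g x) = (LINT x:h ` {0..1}|M. \<phi> x * f x)"
  proof -
    have m: "(\<lambda>y. indicator (h ` {0..1}) y *\<^sub>R (\<phi> y * f y)) \<in> borel_measurable borel"
      by measurable
    \<comment> \<open>Points of (0,1) are mapped into the segment, so its indicator
      disappears.\<close>
    have eq: "indicator {0<..<1} x *\<^sub>R (indicator (h ` {0..1}) (h x) *\<^sub>R (\<phi> (h x) * f (h x))) =
        indicator {0<..<1} x *\<^sub>R (\<phi> (h x) * g x)" for x
      by (simp add: fh indicator_def)
    show "set_integrable M (h ` {0..1}) (\<lambda>x. \<phi> x * f x)"
      using \<phi>g int[OF m] unfolding set_integrable_def eq by blast
    show "(LINT x:{0<..<1}|lborel. \<phi> (h x) * g x) = (LINT x:h ` {0..1}|M. \<phi> x * f x)"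
      using lint[OF m] unfolding set_lebesgue_integral_def eq by simp
  qed
  moreover have "set_borel_measurable borel (h ` {0..1}) \<phi>"
    unfolding set_borel_measurable_def by measurable
  ultimately show ?thesis
    unfolding cm_has_integral_def by blast
qed

section \<open>Suprema and filters\<close>

text \<open>In \<open>ennreal\<close> the supremum exists without a boundedness proof and is 0 over
  the empty set.\<close>

lemma tendsto_SUP_ennreal_0:
  assumes "\<And>e. e > 0 \<Longrightarrow> \<forall>\<^sub>F T in F. \<forall>z\<in>K. f T z \<le> e"
  shows "((\<lambda>T. SUP z\<in>K. ennreal (f T z)) \<longlongrightarrow> 0) F"
proof (rule order_tendstoI)
  fix a :: ennreal assume "0 < a"
  \<comment> \<open>A bound by \<open>y\<close> on every value passes to the supremum only as
    \<open>\<le> y\<close>, so \<open>y\<close> is taken strictly below \<open>a\<close>.\<close>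
  then obtain y where y: "0 < y" "y < a" using dense by blast
  then obtain e where e: "y = ennreal e" "e \<ge> 0" by (cases y) auto
  with y have "e > 0" by (cases "e = 0") auto
  from assms[OF this] show "\<forall>\<^sub>F T in F. (SUP z\<in>K. ennreal (f T z)) < a"
  proof eventually_elim
    case (elim T)
    then have "(SUP z\<in>K. ennreal (f T z)) \<le> y"
      by (intro SUP_least) (auto simp: e intro: ennreal_leI)
    then show ?case using y(2) by simp
  qed
qed simp

text \<open>To be used for L(T) = min_h |\<lambda>_h(T)|, squeezed between T and T plus a constant.
  The restriction to T > 0 matters because this minimum also grows as T tends to minus
  infinity.\<close>

lemma filtercomap_at_top_positive:
  fixes L :: "real \<Rightarrow> real"
  assumes lower: "\<And>T. T > 0 \<Longrightarrow> T \<le> L T" and upper: "\<And>T. T > 0 \<Longrightarrow> L T \<le> B + T"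
  shows "inf (filtercomap L at_top) (principal {0<..}) = at_top"
proof (rule filter_eqI)
  fix P
  have "eventually P (inf (filtercomap L at_top) (principal {0<..})) \<longleftrightarrow>
      (\<exists>x. \<forall>T. L T \<ge> x \<longrightarrow> T > 0 \<longrightarrow> P T)"
    unfolding eventually_inf_principal eventually_filtercomap_at_top_linorder greaterThan_iff ..
  also have "\<dots> \<longleftrightarrow> (\<exists>x. \<forall>T\<ge>x. P T)"
  proof (intro iffI; elim exE)
    fix x assume x: "\<forall>T. L T \<ge> x \<longrightarrow> T > 0 \<longrightarrow> P T"
    have "P T" if "T \<ge> max x 1" for T
      using x lower[of T] that by simp
    then show "\<exists>x. \<forall>T\<ge>x. P T" by blast
  next
    fix x assume x: "\<forall>T\<ge>x. P T"
    have "P T" if "L T \<ge> x + B" "T > 0" for T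
      using x upper[of T] that by simp
    then show "\<exists>x. \<forall>T. L T \<ge> x \<longrightarrow> T > 0 \<longrightarrow> P T" by blast
  qed
  also have "\<dots> \<longleftrightarrow> eventually P at_top" by (simp add: eventually_at_top_linorder)
  finally show "eventually P (inf (filtercomap L at_top) (principal {0<..})) \<longleftrightarrow> eventually P at_top" .
qed

subsection \<open>The rescaled transforms\<close>

text \<open>The lower bounds on \<open>c\<close> enter as positivity of Re (\<lambda>_h + \<kappa>_i
  + 1), the form in which the Gamma factors use them.\<close>

locale jacobi_limit =
  fixes p q r :: nat and a b \<kappa> :: "complex vec" and c :: "real vec"
  assumes r_less: "r < q"
    and a_carrier: "a \<in> carrier_vec r" and b_carrier: "b \<in> carrier_vec q"
    and \<kappa>_carrier: "\<kappa> \<in> carrier_vec p" and c_carrier: "c \<in> carrier_vec (q - r)"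
    and Re_ab: "h < r \<Longrightarrow> Re (b $ h - a $ h) > 0"
    and Re_\<kappa>a: "i < p \<Longrightarrow> h < r \<Longrightarrow> Re (\<kappa> $ i + a $ h + 1) > 0"
    and Re_\<kappa>c: "i < p \<Longrightarrow> h < q - r \<Longrightarrow> Re (\<kappa> $ i) + c $ h + 1 > 0"
    and c_less: "h < q - r \<Longrightarrow> c $ h < Re (b $ (r + h))"
begin

lemma dims [simp]: "dim_vec a = r" "dim_vec b = q" "dim_vec \<kappa> = p" "dim_vec c = q - r"
  "dim_vec (lam c T) = q - r"
  using a_carrier b_carrier \<kappa>_carrier c_carrier by (auto simp: lam_def)

lemma lam_nth: "h < q - r \<Longrightarrow> lam c T $ h = of_real (c $ h) + \<i> * of_real T"
  by (simp add: lam_def)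

lemma norm_lam_ge: "h < q - r \<Longrightarrow> T > 0 \<Longrightarrow> T \<le> cmod (lam c T $ h)"
  using abs_Im_le_cmod[of "lam c T $ h"] by (simp add: lam_nth)

text \<open>The shift by \<kappa>_i + 1 is absorbed into the parameters; the Kronecker delta in
  \<open>\<beta>\<close> comes from the basis vector e_j.\<close>

definition \<alpha> where "\<alpha> i h = \<kappa> $ i + a $ h + 1"
definition \<beta> where "\<beta> i j h = \<kappa> $ i + b $ h + (if j = h then 1 else 0) + 1"
definition coeff where "coeff j i k = gamma_quotient r q (\<alpha> i) (\<beta> i j) k"
definition ratio where "ratio i T k = poch_ratio (q - r) (\<lambda>h. lam c T $ h) (\<kappa> $ i + 1) k"

lemma Re_\<alpha>: "i < p \<Longrightarrow> h < r \<Longrightarrow> Re (\<alpha> i h) > 0"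
  using Re_\<kappa>a by (simp add: \<alpha>_def)

lemma Re_b_minus_append: "h < q \<Longrightarrow> Re (b $ h - (a @\<^sub>v lam c T) $ h) > 0"
  using Re_ab[of h] c_less[of "h - r"] by (cases "h < r") (auto simp: lam_nth)

lemma Re_\<kappa>_append: "i < p \<Longrightarrow> h < q \<Longrightarrow> Re (\<kappa> $ i + (a @\<^sub>v lam c T) $ h + 1) > 0"
  using Re_\<kappa>a[of i h] Re_\<kappa>c[of i "h - r"] by (cases "h < r") (auto simp: lam_nth)

lemma Re_lam_\<kappa>: "i < p \<Longrightarrow> h < q - r \<Longrightarrow> Re (lam c T $ h + \<kappa> $ i + 1) > 0"
  using Re_\<kappa>c[of i h] by (simp add: lam_nth)

text \<open>Add the two positivity facts for the concatenated vector. The value T = 0 is arbitrary,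
  since these real parts do not depend on T.\<close>

lemma Re_\<beta>: "i < p \<Longrightarrow> h < q \<Longrightarrow> Re (\<beta> i j h) > 0"
  using Re_\<kappa>_append[of i h 0] Re_b_minus_append[of h 0] by (simp add: \<beta>_def)

lemma limit_W_entry:
  assumes "j < q" "i < p"
  shows "limit_W a b \<kappa> z $$ (j, i) = (\<Sum>k. coeff j i k * z ^ k)"
proof -
  have num: "Gamma_vec ((of_nat k + \<kappa> $ i) \<cdot>\<^sub>v ones_vec r + a + ones_vec r) = (\<Prod>h<r. Gamma (of_nat k + \<alpha> i h))" for k
    by (simp add: Gamma_vec_def ones_vec_def \<alpha>_def algebra_simps)
  have den: "Gamma_vec ((of_nat k + \<kappa> $ i) \<cdot>\<^sub>v ones_vec q + b + unit_vec q j + ones_vec q) =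
      (\<Prod>h<q. Gamma (of_nat k + \<beta> i j h))" for k
    using assms by (auto simp: Gamma_vec_def ones_vec_def \<beta>_def add_ac intro!: prod.cong)
  show ?thesis
    using assms by (simp add: limit_W_def num den coeff_def gamma_quotient_def)
qed

text \<open>Multiplicativity gives q Gamma quotients. Those numerators that stem from
  \<open>a\<close>, with all denominators, form \<open>coeff\<close>; each remaining numerator is a
  Pochhammer symbol times \<Gamma>(\<lambda>_h + \<kappa>_i + 1), which yields \<open>ratio\<close>,
  a power of \<Lambda> and the entry of D.\<close>

lemma has_moment_jacobi_weight:
  assumes "j < q" "i < p" and T: "T > 0"
  shows "has_moment (jacobi_weight a b (lam c T) j) (\<kappa> $ i + of_nat k)
     (coeff j i k * ratio i T k * Lam (lam c T) ^ k * (\<Prod>h<q - r. Gamma (lam c T $ h + \<kappa> $ i + 1)))"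
proof -
  let ?l = "lam c T"
  have nz: "?l $ h \<noteq> 0" if "h < q - r" for h using norm_lam_ge[OF that T] T by auto
  \<comment> \<open>\<open>mellin_convs F n\<close> has n + 1 factors, so q kernels correspond to
    the index q - 1.\<close>
  have Q: "{..q - 1} = {..<q}" using r_less by auto
  have "has_moment (jacobi_weight a b ?l j) (\<kappa> $ i + of_nat k)
     (\<Prod>h\<le>q - 1. Gamma (\<kappa> $ i + of_nat k + (a @\<^sub>v ?l) $ h + 1) /
        Gamma (\<kappa> $ i + of_nat k + (b $ h + (if j = h then 1 else 0)) + 1))"
    unfolding jacobi_weight_def dims
  proof (intro has_moment_mellin_convs has_moment_beta_kernel)
    fix h assume "h \<le> q - 1"
    then have h: "h < q" using r_less by simp
    show "0 < Re (\<kappa> $ i + of_nat k + (a @\<^sub>v ?l) $ h + 1)" using Re_\<kappa>_append[OF \<open>i < p\<close> h, of T] by simp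
    show "0 < Re (b $ h + (if j = h then 1 else 0) - (a @\<^sub>v ?l) $ h)" using Re_b_minus_append[OF h, of T] by simp
  qed
  also have "(\<Prod>h\<le>q - 1. Gamma (\<kappa> $ i + of_nat k + (a @\<^sub>v ?l) $ h + 1) /
        Gamma (\<kappa> $ i + of_nat k + (b $ h + (if j = h then 1 else 0)) + 1)) =
      (\<Prod>h<q. Gamma (\<kappa> $ i + of_nat k + (a @\<^sub>v ?l) $ h + 1)) / (\<Prod>h<q. Gamma (of_nat k + \<beta> i j h))"
    unfolding Q prod_dividef by (simp add: \<beta>_def add_ac)
  also have "(\<Prod>h<q. Gamma (\<kappa> $ i + of_nat k + (a @\<^sub>v ?l) $ h + 1)) =
      (\<Prod>h<r. Gamma (of_nat k + \<alpha> i h)) * (\<Prod>h<q - r. Gamma (of_nat k + (?l $ h + \<kappa> $ i + 1)))"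
  proof -
    have "(\<Prod>h<q. Gamma (\<kappa> $ i + of_nat k + (a @\<^sub>v ?l) $ h + 1)) =
       (\<Prod>h\<in>{0..<r}. Gamma (\<kappa> $ i + of_nat k + (a @\<^sub>v ?l) $ h + 1)) *
       (\<Prod>h\<in>{r..<q}. Gamma (\<kappa> $ i + of_nat k + (a @\<^sub>v ?l) $ h + 1))"
      using r_less by (subst prod.atLeastLessThan_concat) (auto simp: atLeast0LessThan)
    also have "(\<Prod>h\<in>{0..<r}. Gamma (\<kappa> $ i + of_nat k + (a @\<^sub>v ?l) $ h + 1)) = (\<Prod>h<r. Gamma (of_nat k + \<alpha> i h))"
      using r_less by (intro prod.cong) (auto simp: \<alpha>_def add_ac)
    also have "(\<Prod>h\<in>{r..<q}. Gamma (\<kappa> $ i + of_nat k + (a @\<^sub>v ?l) $ h + 1)) =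
        (\<Prod>h\<in>{0..<q - r}. Gamma (\<kappa> $ i + of_nat k + (a @\<^sub>v ?l) $ (h + r) + 1))"
      using r_less prod.shift_bounds_nat_ivl[of "\<lambda>h. Gamma (\<kappa> $ i + of_nat k + (a @\<^sub>v ?l) $ h + 1)" 0 r "q - r"] by simp
    also have "\<dots> = (\<Prod>h<q - r. Gamma (of_nat k + (?l $ h + \<kappa> $ i + 1)))"
      using r_less by (intro prod.cong) (auto simp: add_ac)
    finally show ?thesis .
  qed
  \<comment> \<open>Inserting \<lambda>_h^k above and below isolates the power that the rescaling by
    \<Lambda> removes.\<close>
  also have "(\<Prod>h<q - r. Gamma (of_nat k + (?l $ h + \<kappa> $ i + 1))) =
     (\<Prod>h<q - r. pochhammer (?l $ h + (\<kappa> $ i + 1)) k / ?l $ h ^ k * ?l $ h ^ k * Gamma (?l $ h + \<kappa> $ i + 1))"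
  proof (intro prod.cong refl)
    fix h assume "h \<in> {..<q - r}"
    then have h: "h < q - r" by simp
    have Re: "Re (?l $ h + \<kappa> $ i + 1) > 0" using Re_lam_\<kappa>[OF \<open>i < p\<close> h] .
    then have "?l $ h + \<kappa> $ i + 1 \<notin> \<int>\<^sub>\<le>\<^sub>0" using Gamma_ne_0_Re_pos[OF Re] by (auto simp: Gamma_eq_zero_iff)
    from pochhammer_Gamma[OF this, of k] Gamma_ne_0_Re_pos[OF Re]
    show "Gamma (of_nat k + (?l $ h + \<kappa> $ i + 1)) =
       pochhammer (?l $ h + (\<kappa> $ i + 1)) k / ?l $ h ^ k * ?l $ h ^ k * Gamma (?l $ h + \<kappa> $ i + 1)"
      using nz[OF h] by (simp add: add_ac)
  qed
  also have "\<dots> = ratio i T k * Lam ?l ^ k * (\<Prod>h<q - r. Gamma (?l $ h + \<kappa> $ i + 1))"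
    unfolding prod.distrib ratio_def poch_ratio_def Lam_def by (simp add: prod_power_distrib)
  finally show ?thesis
    by (simp only: coeff_def gamma_quotient_def times_divide_eq_left times_divide_eq_right mult.assoc)
qed

section \<open>Power series of the rescaled transforms\<close>

text \<open>Each factor has modulus at least T, and T \<le> T^(q - r) because T > 1 and q - r \<ge>
  1.\<close>

lemma norm_Lam_gt:
  assumes "T > 1" "T > R"
  shows "R < cmod (Lam (lam c T))"
proof -
  have "T ^ 1 \<le> T ^ (q - r)" using assms r_less by (intro power_increasing) auto
  also have "\<dots> = (\<Prod>h<q - r. T)" by simp
  also have "\<dots> \<le> cmod (Lam (lam c T))"
    unfolding Lam_def dims prod_norm[symmetric] using assms norm_lam_ge[of _ T] by (intro prod_mono) auto
  finally show ?thesis using assms by simp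
qed

lemma Lam_nz: "T > 0 \<Longrightarrow> Lam (lam c T) \<noteq> 0"
  using norm_lam_ge[of _ T] by (fastforce simp: Lam_def)

abbreviation D where "D T i \<equiv> \<Prod>h<q - r. Gamma (lam c T $ h + \<kappa> $ i + 1)"

lemma D_nz: "i < p \<Longrightarrow> D T i \<noteq> 0"
  using Re_lam_\<kappa> by (auto intro!: Gamma_ne_0_Re_pos simp del: plus_complex.simps)

text \<open>The density on (0,1) of an entry of the normalised measure, before the
  push-forward.\<close>

abbreviation dens where "dens T j i x \<equiv> of_real x powr (\<kappa> $ i) * jacobi_weight a b (lam c T) j x / D T i"

lemma rescaled_measure_dim [simp]:
  "dim_row (rescaled_measure a b \<kappa> (lam c T)) = q" "dim_col (rescaled_measure a b \<kappa> (lam c T)) = p"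
proof -
  have "mat_inverse (D_mat \<kappa> (lam c T)) = Some (mat_diag p (\<lambda>i. 1 / D T i))"
    unfolding D_mat_def dims by (intro mat_inverse_mat_diag D_nz)
  then show "dim_row (rescaled_measure a b \<kappa> (lam c T)) = q" "dim_col (rescaled_measure a b \<kappa> (lam c T)) = p"
    by (auto simp: rescaled_measure_def cm_mat_mult_def jacobi_measure_def mat_diag_def)
qed

text \<open>The inverse of D is diagonal, so only the term \<open>k = i\<close> of the matrix
  product survives.\<close>

lemma rescaled_measure_entry:
  assumes "j < q" "i < p"
  shows "(rescaled_measure a b \<kappa> (lam c T) $$ (j, i)) B =
    (LINT x:((\<lambda>x. of_real x / Lam (lam c T)) -` B) \<inter> {0<..<1}|lborel. dens T j i x)"
proof -
  let ?h = "\<lambda>x. of_real x / Lam (lam c T)"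
  let ?w = "\<lambda>k x. jacobi_weight a b (lam c T) j x * of_real x powr (\<kappa> $ k)"
  have inv: "mat_inverse (D_mat \<kappa> (lam c T)) = Some (mat_diag p (\<lambda>i. 1 / D T i))"
    unfolding D_mat_def dims by (intro mat_inverse_mat_diag D_nz)
  have "(rescaled_measure a b \<kappa> (lam c T) $$ (j, i)) B =
      (\<Sum>k<p. (LINT x:(?h -` B) \<inter> {0<..<1}|lborel. ?w k x) * (if k = i then 1 / D T i else 0))"
    using assms unfolding rescaled_measure_def inv
    by (simp add: cm_mat_mult_def jacobi_measure_def mat_diag_def cm_push_forward_def)
  also have "\<dots> = (LINT x:(?h -` B) \<inter> {0<..<1}|lborel. ?w i x) * (1 / D T i)"
    using assms by (simp add: if_distrib sum.delta cong: if_cong)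
  also have "\<dots> = (LINT x:(?h -` B) \<inter> {0<..<1}|lborel. ?w i x * (1 / D T i))"
    by (simp only: set_integral_mult_left)
  finally show ?thesis by (simp add: mult_ac)
qed

text \<open>Apply the geometric series of moments with w = z / \<Lambda>, of modulus below 1. The
  powers of \<Lambda> and the entry of D contained in the moments cancel.\<close>

lemma dens_integral:
  assumes "j < q" "i < p" "T > 0" "cmod z < cmod (Lam (lam c T))"
  shows "set_integrable lborel {0<..<1} (\<lambda>x. 1 / (1 - of_real x / Lam (lam c T) * z) * dens T j i x)"
    and "(\<lambda>k. coeff j i k * ratio i T k * z ^ k) sums
      (LINT x:{0<..<1}|lborel. 1 / (1 - of_real x / Lam (lam c T) * z) * dens T j i x)"
proof -
  let ?L = "Lam (lam c T)"
  let ?g = "\<lambda>x. indicator {0<..<1} x *\<^sub>R (complex_of_real x powr (\<kappa> $ i) * jacobi_weight a b (lam c T) j x /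
      (1 - of_real x * (z / ?L)))"
  have w: "cmod (z / ?L) < 1" using assms(4) by (simp add: norm_divide divide_less_eq)
  note series = has_moment_geometric_series[OF has_moment_jacobi_weight[OF assms(1-3)] w]
  have eq: "?g x / D T i = indicator {0<..<1} x *\<^sub>R (1 / (1 - of_real x / ?L * z) * dens T j i x)" for x
    by (simp add: indicator_def mult_ac)
  have "integrable lborel (\<lambda>x. ?g x / D T i)"
    using series(1) by (intro integrable_divide)
  then show "set_integrable lborel {0<..<1} (\<lambda>x. 1 / (1 - of_real x / ?L * z) * dens T j i x)"
    unfolding set_integrable_def eq .
  have "(\<lambda>k. coeff j i k * ratio i T k * ?L ^ k * D T i * (z / ?L) ^ k / D T i) sums (integral\<^sup>L lborel ?g / D T i)"
    using series(2) by (rule sums_divide)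
  also have "(\<lambda>k. coeff j i k * ratio i T k * ?L ^ k * D T i * (z / ?L) ^ k / D T i) =
      (\<lambda>k. coeff j i k * ratio i T k * z ^ k)"
    using Lam_nz[OF assms(3)] D_nz[OF assms(2), of T] by (simp add: power_divide mult_ac)
  also have "integral\<^sup>L lborel ?g / D T i = (LINT x|lborel. ?g x / D T i)" by simp
  finally show "(\<lambda>k. coeff j i k * ratio i T k * z ^ k) sums
      (LINT x:{0<..<1}|lborel. 1 / (1 - of_real x / ?L * z) * dens T j i x)"
    unfolding eq set_lebesgue_integral_def .
qed

lemma cm_integral_rescaled_measure:
  assumes "j < q" "i < p" "T > 0" and [measurable]: "\<phi> \<in> borel_measurable borel"
    and "set_integrable lborel {0<..<1} (\<lambda>x. \<phi> (of_real x / Lam (lam c T)) * dens T j i x)"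
  shows "cm_integral (rescaled_measure a b \<kappa> (lam c T) $$ (j, i)) (Delta (lam c T)) \<phi> =
     (LINT x:{0<..<1}|lborel. \<phi> (of_real x / Lam (lam c T)) * dens T j i x)"
  unfolding Delta_def
proof (rule cm_integral_eq, rule cm_has_integral_push_forward)
  have [measurable]: "jacobi_weight a b (lam c T) j \<in> borel_measurable borel"
    using has_moment_jacobi_weight[OF assms(1-3)] by (simp add: has_moment_def)
  show "dens T j i \<in> borel_measurable borel" by measurable
  \<comment> \<open>Integrability of the density itself is the case z = 0 of the transform.\<close>
  show "set_integrable lborel {0<..<1} (dens T j i)"
    using dens_integral(1)[OF assms(1-3), of 0] Lam_nz[OF assms(3)] by simp
qed (use assms Lam_nz rescaled_measure_entry in auto)

lemma W_hat_entry:
  assumes "j < q" "i < p" "T > 0" "cmod z < cmod (Lam (lam c T))"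
  shows "(\<lambda>k. coeff j i k * ratio i T k * z ^ k) sums (W_hat a b \<kappa> (lam c T) z $$ (j, i))"
proof -
  have "W_hat a b \<kappa> (lam c T) z $$ (j, i) =
      (LINT x:{0<..<1}|lborel. 1 / (1 - of_real x / Lam (lam c T) * z) * dens T j i x)"
    unfolding W_hat_def using assms(1,2)
    by (simp add: cm_integral_rescaled_measure[OF assms(1-3) _ dens_integral(1)[OF assms]] del: times_divide_eq_left)
  then show ?thesis using dens_integral(2)[OF assms] by simp
qed

text \<open>The identity 1/(z - y) = (1/z) / (1 - y/z) is applied under the integral.\<close>

lemma C_hat_eq:
  assumes "T > 0" "z \<noteq> 0" "cmod (1 / z) < cmod (Lam (lam c T))"
  shows "C_hat a b \<kappa> (lam c T) z = (1 / z) \<cdot>\<^sub>m W_hat a b \<kappa> (lam c T) (1 / z)"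
proof (rule eq_matI)
  fix j i assume "j < dim_row ((1 / z) \<cdot>\<^sub>m W_hat a b \<kappa> (lam c T) (1 / z))"
    "i < dim_col ((1 / z) \<cdot>\<^sub>m W_hat a b \<kappa> (lam c T) (1 / z))"
  then have ji: "j < q" "i < p" by (auto simp: W_hat_def)
  let ?h = "\<lambda>x. complex_of_real x / Lam (lam c T)"
  note d = dens_integral[OF ji assms(1,3)]
  have eq: "1 / (z - ?h x) * dens T j i x = 1 / z * (1 / (1 - ?h x * (1 / z)) * dens T j i x)" for x
  proof -
    have "1 / (z - ?h x) = 1 / z * (1 / (1 - ?h x * (1 / z)))"
      using \<open>z \<noteq> 0\<close> by (simp add: algebra_simps)
    then show ?thesis by (simp only: mult.assoc)
  qed
  have int: "set_integrable lborel {0<..<1} (\<lambda>x. 1 / (z - ?h x) * dens T j i x)"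
    unfolding eq using d(1) by (intro set_integrable_mult_right)
  have "C_hat a b \<kappa> (lam c T) z $$ (j, i) = (LINT x:{0<..<1}|lborel. 1 / (z - ?h x) * dens T j i x)"
    unfolding C_hat_def using ji
    by (simp add: cm_integral_rescaled_measure[OF ji assms(1) _ int])
  also have "\<dots> = 1 / z * (LINT x:{0<..<1}|lborel. 1 / (1 - ?h x * (1 / z)) * dens T j i x)"
    unfolding eq by (rule set_integral_mult_right)
  also have "\<dots> = 1 / z * W_hat a b \<kappa> (lam c T) (1 / z) $$ (j, i)"
    using sums_unique2[OF d(2) W_hat_entry[OF ji assms(1,3)]] by simp
  finally show "C_hat a b \<kappa> (lam c T) z $$ (j, i) = ((1 / z) \<cdot>\<^sub>m W_hat a b \<kappa> (lam c T) (1 / z)) $$ (j, i)"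
    using ji by (simp add: W_hat_def)
qed (auto simp: C_hat_def W_hat_def)

lemma W_hat_carrier: "W_hat a b \<kappa> (lam c T) z \<in> carrier_mat q p"
  by (auto simp: W_hat_def)

lemma limit_W_carrier: "limit_W a b \<kappa> z \<in> carrier_mat q p"
  by (auto simp: limit_W_def)

section \<open>Uniform convergence on discs and their inversions\<close>

text \<open>For |z| \<le> R the difference of the two power series is bounded termwise by its
  coefficients times R^k, a sum independent of z that tends to 0.\<close>

lemma W_hat_entry_uniform:
  assumes ji: "j < q" "i < p" and "R \<ge> 0" "e > 0"
  shows "\<forall>\<^sub>F T in at_top. \<forall>z. cmod z \<le> R \<longrightarrow>
    cmod ((W_hat a b \<kappa> (lam c T) z - limit_W a b \<kappa> z) $$ (j, i)) \<le> e"
proof -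
  let ?u = "\<lambda>T k. cmod (coeff j i k * (ratio i T k - 1)) * R ^ k"
  have l: "T \<le> cmod (lam c T $ h)" if "T > 0" "h < q - r" for T h
    using that by (intro norm_lam_ge)
  note conv = poch_ratio_series_convergence[where \<alpha> = "\<alpha> i" and \<beta> = "\<beta> i j" and l = "\<lambda>T h. lam c T $ h",
      OF r_less Re_\<alpha>[OF ji(2)] Re_\<beta>[OF ji(2)] \<open>R \<ge> 0\<close> l, folded coeff_def]
  have c: "summable (\<lambda>k. cmod (coeff j i k) * R ^ k)"
    by (rule conv(1))
  have s: "\<forall>\<^sub>F T in at_top. summable (?u T)" and lim: "((\<lambda>T. suminf (?u T)) \<longlongrightarrow> 0) at_top"
    unfolding ratio_def by (rule conv(2), assumption+) (rule conv(3), assumption+)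
  show ?thesis
    \<comment> \<open>The last two conditions force |\<Lambda>| > R, so the series represents
      \<open>W_hat\<close> on the whole disc.\<close>
    using s order_tendstoD(2)[OF lim \<open>e > 0\<close>] eventually_gt_at_top[of 1] eventually_gt_at_top[of R]
  proof eventually_elim
    case (elim T)
    show ?case
    proof (intro allI impI)
      fix z assume z: "cmod z \<le> R"
      then have "cmod z < cmod (Lam (lam c T))" using norm_Lam_gt[of T R] elim by simp
      from W_hat_entry[OF ji _ this] elim
      have W: "(\<lambda>k. coeff j i k * ratio i T k * z ^ k) sums (W_hat a b \<kappa> (lam c T) z $$ (j, i))" by simp
      have zR: "cmod z ^ k \<le> R ^ k" for k using z by (intro power_mono) auto
      have "summable (\<lambda>k. coeff j i k * z ^ k)"
        by (rule summable_comparison_test'[OF c])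
           (auto simp: norm_mult norm_power intro!: mult_left_mono zR)
      then have "(\<lambda>k. coeff j i k * z ^ k) sums (limit_W a b \<kappa> z $$ (j, i))"
        unfolding limit_W_entry[OF ji] by (rule summable_sums)
      from sums_diff[OF W this]
      have d: "(\<lambda>k. coeff j i k * (ratio i T k - 1) * z ^ k) sums
          ((W_hat a b \<kappa> (lam c T) z - limit_W a b \<kappa> z) $$ (j, i))"
        using ji W_hat_carrier[of T z] limit_W_carrier[of z] by (simp add: algebra_simps)
      have le: "norm (coeff j i k * (ratio i T k - 1) * z ^ k) \<le> ?u T k" for k
        by (simp only: norm_mult norm_power) (intro mult_left_mono zR mult_nonneg_nonneg norm_ge_zero)
      have "cmod (\<Sum>k. coeff j i k * (ratio i T k - 1) * z ^ k) \<le> suminf (?u T)"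
        using elim(1) le by (intro norm_suminf_le)
      then show "cmod ((W_hat a b \<kappa> (lam c T) z - limit_W a b \<kappa> z) $$ (j, i)) \<le> e"
        using elim(2) sums_unique[OF d] by simp
    qed
  qed
qed

lemma W_hat_uniform:
  assumes "matrix_norm q p N" "R \<ge> 0" "e > 0"
  shows "\<forall>\<^sub>F T in at_top. \<forall>z. cmod z \<le> R \<longrightarrow> N (W_hat a b \<kappa> (lam c T) z - limit_W a b \<kappa> z) \<le> e"
proof -
  obtain C where C: "C \<ge> 0" and NC: "\<And>A e. A \<in> carrier_mat q p \<Longrightarrow>
      (\<And>j i. j < q \<Longrightarrow> i < p \<Longrightarrow> cmod (A $$ (j, i)) \<le> e) \<Longrightarrow> N A \<le> C * e"
    using matrix_norm_le_entries[OF assms(1)] by blast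
  \<comment> \<open>The summand 1 keeps the quotient meaningful when \<open>C = 0\<close>.\<close>
  define e' where "e' = e / (C + 1)"
  have e': "e' > 0" "C * e' \<le> e"
    using C \<open>e > 0\<close> by (auto simp: e'_def field_simps)
  have "\<forall>\<^sub>F T in at_top. \<forall>j\<in>{..<q}. \<forall>i\<in>{..<p}. \<forall>z. cmod z \<le> R \<longrightarrow>
      cmod ((W_hat a b \<kappa> (lam c T) z - limit_W a b \<kappa> z) $$ (j, i)) \<le> e'"
    using assms e' by (intro eventually_ball_finite ballI finite_lessThan W_hat_entry_uniform) auto
  then show ?thesis
  proof eventually_elim
    case (elim T)
    show ?case
    proof (intro allI impI)
      fix z assume "cmod z \<le> R"
      with elim have "cmod ((W_hat a b \<kappa> (lam c T) z - limit_W a b \<kappa> z) $$ (j, i)) \<le> e'"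
        if "j < q" "i < p" for j i using that by blast
      then have "N (W_hat a b \<kappa> (lam c T) z - limit_W a b \<kappa> z) \<le> C * e'"
        by (intro NC minus_carrier_mat limit_W_carrier)
      then show "N (W_hat a b \<kappa> (lam c T) z - limit_W a b \<kappa> z) \<le> e" using e'(2) by simp
    qed
  qed
qed

text \<open>Apply the estimate for \<open>W_hat\<close> at 1/z with tolerance \<open>e / R\<close>;
  the prefactor 1/z costs at most a factor \<open>R\<close>.\<close>

lemma C_hat_uniform:
  assumes N: "matrix_norm q p N" and "R > 0" "e > 0"
  shows "\<forall>\<^sub>F T in at_top. \<forall>z. z \<noteq> 0 \<and> cmod (1 / z) \<le> R \<longrightarrow> N (C_hat a b \<kappa> (lam c T) z - limit_C a b \<kappa> z) \<le> e"
proof -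
  have "R \<ge> 0" "e / R > 0" using assms by auto
  from W_hat_uniform[OF N this] show ?thesis
    using eventually_gt_at_top[of 1] eventually_gt_at_top[of R]
  proof eventually_elim
    case (elim T)
    show ?case
    proof (intro allI impI)
      fix z :: complex assume "z \<noteq> 0 \<and> cmod (1 / z) \<le> R"
      then have z: "z \<noteq> 0" "cmod (1 / z) \<le> R" by auto
      let ?A = "W_hat a b \<kappa> (lam c T) (1 / z) - limit_W a b \<kappa> (1 / z)"
      have car: "?A \<in> carrier_mat q p" by (intro minus_carrier_mat limit_W_carrier)
      have "cmod (1 / z) < cmod (Lam (lam c T))" using norm_Lam_gt[of T R] elim z by simp
      then have "C_hat a b \<kappa> (lam c T) z - limit_C a b \<kappa> z = (1 / z) \<cdot>\<^sub>m ?A"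
        using C_hat_eq[of T z] z elim W_hat_carrier[of T "1 / z"] limit_W_carrier[of "1 / z"]
        by (intro eq_matI) (auto simp: limit_C_def algebra_simps)
      then have "N (C_hat a b \<kappa> (lam c T) z - limit_C a b \<kappa> z) = cmod (1 / z) * N ?A"
        using N car by (simp add: matrix_norm_def)
      also have "\<dots> \<le> R * (e / R)"
        using elim z N car \<open>R > 0\<close> by (intro mult_mono) (auto simp: matrix_norm_def)
      finally show "N (C_hat a b \<kappa> (lam c T) z - limit_C a b \<kappa> z) \<le> e" using \<open>R > 0\<close> by simp
    qed
  qed
qed

end

section \<open>Passage to compact sets\<close>

theorem theorem3p11:
  fixes p q r :: nat and a b \<kappa> :: "complex vec" and c :: "real vec"
    and N :: "complex mat \<Rightarrow> real"
  assumes "p \<ge> 1" and "q \<ge> 1" and "r < q"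
    and "a \<in> carrier_vec r" and "b \<in> carrier_vec q" and "\<kappa> \<in> carrier_vec p"
    and "\<And>j h. j < q \<Longrightarrow> h < q \<Longrightarrow> j \<noteq> h \<Longrightarrow> b $ j - b $ h \<notin> \<int>"
    and "\<And>i h. i < p \<Longrightarrow> h < p \<Longrightarrow> i \<noteq> h \<Longrightarrow> \<kappa> $ i - \<kappa> $ h \<notin> \<int>"
    and "\<And>h. h < r \<Longrightarrow> Re (a $ h) > -1"
    and "\<And>h. h < r \<Longrightarrow> Re (b $ h - a $ h) > 0"
    and "\<And>i h. i < p \<Longrightarrow> h < r \<Longrightarrow> Re (\<kappa> $ i + a $ h + 1) > 0"
    and "c \<in> carrier_vec (q - r)"
    and "\<And>h. h < q - r \<Longrightarrow> max (-1) (MAX i\<in>{..<p}. -1 - Re (\<kappa> $ i)) < c $ h"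
    and "\<And>h. h < q - r \<Longrightarrow> c $ h < Re (b $ (r + h))"
    and "\<And>T. T > 0 \<Longrightarrow> gamma_factors_finite a b \<kappa> (lam c T)"
    and "matrix_norm q p N"
  shows
    "inf (filtercomap (\<lambda>T. MIN h\<in>{..<q - r}. cmod (lam c T $ h)) at_top) (principal {0<..})
       = (at_top :: real filter) \<and>
     (\<forall>K. compact K \<longrightarrow>
        (\<forall>\<^sub>F T in at_top. K \<subseteq> {z. cmod z < cmod (Lam (lam c T))}) \<and>
        ((\<lambda>T. SUP z\<in>K. ennreal (N (W_hat a b \<kappa> (lam c T) z - limit_W a b \<kappa> z)))
           \<longlongrightarrow> 0) at_top) \<and>
     (\<forall>K. compact K \<longrightarrow> K \<subseteq> - {0} \<longrightarrow>
        (\<forall>\<^sub>F T in at_top. K \<inter> Delta (lam c T) = {}) \<and>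
        ((\<lambda>T. SUP z\<in>K. ennreal (N (C_hat a b \<kappa> (lam c T) z - limit_C a b \<kappa> z)))
           \<longlongrightarrow> 0) at_top) \<and>
     ((\<lambda>T. SUP z\<in>sphere 0 1. ennreal (N (C_hat a b \<kappa> (lam c T) z - limit_C a b \<kappa> z)))
        \<longlongrightarrow> 0) at_top"
proof -
  have \<kappa>c: "Re (\<kappa> $ i) + c $ h + 1 > 0" if "i < p" "h < q - r" for i h
  proof -
    have "-1 - Re (\<kappa> $ i) \<le> (MAX i\<in>{..<p}. -1 - Re (\<kappa> $ i))"
      using that by (intro Max_ge) auto
    with assms(13)[OF that(2)] show ?thesis by linarith
  qed
  interpret jacobi_limit p q r a b \<kappa> c
    by unfold_locales (use assms \<kappa>c in auto)
  note N = assms(16)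
  let ?min = "\<lambda>T. MIN h\<in>{..<q - r}. cmod (lam c T $ h)"
  have fin: "finite ((\<lambda>h. cmod (lam c T $ h)) ` {..<q - r})" for T by simp
  have ne: "(\<lambda>h. cmod (lam c T $ h)) ` {..<q - r} \<noteq> {}" for T using \<open>r < q\<close> by (auto simp: lessThan_empty_iff)
  have filt: "inf (filtercomap ?min at_top) (principal {0<..}) = (at_top :: real filter)"
  \<comment> \<open>The upper bound comes from the entry of index 0, which exists because r <
    q.\<close>
  proof (rule filtercomap_at_top_positive[where B = "\<bar>c $ 0\<bar>"])
    fix T :: real assume T: "T > 0"
    show "T \<le> ?min T"
      using T by (intro Min.boundedI fin ne) (auto intro: norm_lam_ge)
    have "?min T \<le> cmod (lam c T $ 0)"
      using \<open>r < q\<close> by (intro Min_le fin) auto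
    also have "\<dots> \<le> \<bar>c $ 0\<bar> + T"
      using norm_triangle_ineq[of "complex_of_real (c $ 0)" "\<i> * of_real T"] T \<open>r < q\<close>
      by (simp add: lam_nth norm_mult)
    finally show "?min T \<le> \<bar>c $ 0\<bar> + T" .
  qed
  have ball: "\<forall>\<^sub>F T in at_top. K \<subseteq> {z. cmod z < cmod (Lam (lam c T))}" if K: "\<And>z. z \<in> K \<Longrightarrow> cmod z \<le> R" for K R
    using eventually_gt_at_top[of 1] eventually_gt_at_top[of R]
  proof eventually_elim
    case (elim T)
    then show ?case using norm_Lam_gt[of T R] K by fastforce
  qed
  have W: "(\<forall>\<^sub>F T in at_top. K \<subseteq> {z. cmod z < cmod (Lam (lam c T))}) \<and>
        ((\<lambda>T. SUP z\<in>K. ennreal (N (W_hat a b \<kappa> (lam c T) z - limit_W a b \<kappa> z))) \<longlongrightarrow> 0) at_top"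
    if K: "compact K" for K
  proof -
    obtain R where R: "R > 0" "\<And>z. z \<in> K \<Longrightarrow> cmod z \<le> R"
      using compact_imp_bounded[OF K] by (auto simp: bounded_pos)
    have "\<forall>\<^sub>F T in at_top. \<forall>z\<in>K. N (W_hat a b \<kappa> (lam c T) z - limit_W a b \<kappa> z) \<le> e" if "e > 0" for e
      using W_hat_uniform[OF N less_imp_le[OF R(1)] that] by (rule eventually_mono) (simp add: R(2))
    then show ?thesis by (intro conjI ball[OF R(2)] tendsto_SUP_ennreal_0)
  qed
  have C: "(\<forall>\<^sub>F T in at_top. K \<inter> Delta (lam c T) = {}) \<and>
        ((\<lambda>T. SUP z\<in>K. ennreal (N (C_hat a b \<kappa> (lam c T) z - limit_C a b \<kappa> z))) \<longlongrightarrow> 0) at_top"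
    if K: "compact K" "K \<subseteq> - {0}" for K
  proof -
    \<comment> \<open>Inversion is continuous away from 0, so compactness of the image bounds |1/z|
      on \<open>K\<close>.\<close>
    have "compact ((\<lambda>z. 1 / z) ` K)"
      using K by (intro compact_continuous_image continuous_intros) auto
    from compact_imp_bounded[OF this] obtain R where R: "R > 0" "\<And>z. z \<in> K \<Longrightarrow> cmod (1 / z) \<le> R"
      unfolding bounded_pos by blast
    have "\<forall>\<^sub>F T in at_top. \<forall>z\<in>K. N (C_hat a b \<kappa> (lam c T) z - limit_C a b \<kappa> z) \<le> e" if "e > 0" for e
      using C_hat_uniform[OF N R(1) that]
    proof (rule eventually_mono, intro ballI)
      fix T z assume *: "\<forall>z. z \<noteq> 0 \<and> cmod (1 / z) \<le> R \<longrightarrow> N (C_hat a b \<kappa> (lam c T) z - limit_C a b \<kappa> z) \<le> e"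
        and z: "z \<in> K"
      have "z \<noteq> 0" using z K(2) by auto
      with * R(2)[OF z] show "N (C_hat a b \<kappa> (lam c T) z - limit_C a b \<kappa> z) \<le> e" by simp
    qed
    moreover have "\<forall>\<^sub>F T in at_top. K \<inter> Delta (lam c T) = {}"
      using eventually_gt_at_top[of 1] eventually_gt_at_top[of R]
    proof eventually_elim
      case (elim T)
      \<comment> \<open>A nonzero point x / \<Lambda> of the segment has |1/z| = |\<Lambda>| / x
        \<ge> |\<Lambda>| > R, which contradicts the bound on \<open>K\<close>.\<close>
      have "z \<notin> Delta (lam c T)" if "z \<in> K" for z
      proof
        assume "z \<in> Delta (lam c T)"
        then obtain x where x: "0 \<le> x" "x \<le> 1" "z = of_real x / Lam (lam c T)" by (auto simp: Delta_def)
        have "x \<noteq> 0" using x(3) K(2) that by auto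
        then have "1 \<le> 1 / x" using x by simp
        then have "cmod (Lam (lam c T)) * 1 \<le> cmod (Lam (lam c T)) * (1 / x)" by (intro mult_left_mono) auto
        also have "\<dots> = cmod (1 / z)" using x by (simp add: norm_divide)
        finally show False using R(2)[OF that] norm_Lam_gt[of T R] elim by simp
      qed
      then show ?case by blast
    qed
    ultimately show ?thesis by (intro conjI tendsto_SUP_ennreal_0)
  qed
  have "sphere 0 1 \<subseteq> - {0 :: complex}" by auto
  then show ?thesis
    by (intro conjI allI impI filt W[THEN conjunct1] W[THEN conjunct2]
        C[THEN conjunct1] C[THEN conjunct2] compact_sphere)
qed

end
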